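(* $\#\Pi_1^{\mathrm{Sk}} \subsetneq \#\Pi_1$.
   Context: Structures: a finite $\sigma$-structure has universe $\{0,\dots,n-1\}$, $n\ge1$; built-in $\le$ (usual order), $\min=0$, $\mathrm{BIT}(i,j)$ iff the $i$-th bit of $j$ is $1$. $\mathrm{enc}_\sigma(\mathcal{A})$ is the standard binary encoding (non-built-in relations as $0/1$ truth values of all tuples in lexicographic order, non-built-in constants in binary of length $\lceil\log_2 n\rceil$; built-ins not encoded). $\#\Pi_1$: $f:\{0,1\}^*\to\mathbb{N}$ is in $\#\Pi_1$ if there are a vocabulary $\sigma$ containing built-in $\le,\mathrm{BIT},\min$ and a formula $\varphi(F_1,\dots,F_k,x_1,\dots,x_\ell)=\forall y_1\cdots\forall y_m\,\psi$, $\psi$ quantifier-free, with free function variables $F_i$ of arity $a_i$ (usable in terms) and free individual variables $x_j$, such that for every $\sigma$-structure $\mathcal{A}$, $f(\mathrm{enc}_\sigma(\mathcal{A}))$ is the number of tuples $(f_1,\dots,f_k,c_1,\dots,c_\ell)$ with $f_i:\mathrm{dom}(\mathcal{A})^{a_i}\to\mathrm{dom}(\mathcal{A})$, $c_j\in\mathrm{dom}(\mathcal{A})$, $\mathcal{A}\models\varphi(\bar f,\bar c)$. $\#\Pi_1^{\mathrm{Sk}}$: $f$ is in $\#\Pi_1^{\mathrm{Sk}}$ if there are a vocabulary $\sigma$ containing built-in $\le,\mathrm{BIT},\min$ and a first-order sentence $\exists y_1\forall z_1\exists y_2\forall z_2\cdots\exists y_{k-1}\forall z_{k-1}\exists y_k\,\psi(\bar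 y,\bar z)$ with $\psi$ quantifier-free such that for every $\sigma$-structure $\mathcal{A}$, $f(\mathrm{enc}_\sigma(\mathcal{A}))$ is the number of tuples $(f_1,\dots,f_k)$, $f_i:\mathrm{dom}(\mathcal{A})^{i-1}\to\mathrm{dom}(\mathcal{A})$, with $\mathcal{A}\models\forall z_1\cdots\forall z_{k-1}\,\psi(f_1,f_2(z_1),\dots,f_k(z_1,\dots,z_{k-1}),z_1,\dots,z_{k-1})$ (i.e. the number of Skolem functions). *)

theory Defs
  imports Complex_Main "HOL-Library.FuncSet"
begin

text \<open>
  A vocabulary is given by its symbols other than the built-in \<open>\<le>\<close>, \<open>BIT\<close>, \<open>min\<close>, which belong
  to every vocabulary: the arities of the relation symbols and the number of constant symbols.
  Relation symbols have positive arity.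
\<close>

record vocab =
  rel_arities :: "nat list"
  num_csts :: nat

definition vocabulary :: "vocab \<Rightarrow> bool" where
  "vocabulary \<sigma> \<longleftrightarrow> (\<forall>a\<in>set (rel_arities \<sigma>). 1 \<le> a)"

record struct =
  usize :: nat
  rels :: "nat list set list"
  csts :: "nat list"

definition universe :: "struct \<Rightarrow> nat set" where
  "universe A = {..<usize A}"

definition tuples :: "'a set \<Rightarrow> nat \<Rightarrow> 'a list set" where
  "tuples U a = {xs. length xs = a \<and> set xs \<subseteq> U}"

definition is_struct :: "vocab \<Rightarrow> struct \<Rightarrow> bool" where
  "is_struct \<sigma> A \<longleftrightarrow>
     1 \<le> usize A \<and>
     list_all2 (\<lambda>R a. R \<subseteq> tuples (universe A) a) (rels A) (rel_arities \<sigma>) \<and>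
     csts A \<in> tuples (universe A) (num_csts \<sigma>)"


text \<open>
  \<^const>\<open>product_lists\<close> enumerates the tuples in lexicographic order;
  constants are written with the most significant bit first.
\<close>

definition enc_rel :: "nat \<Rightarrow> nat \<Rightarrow> nat list set \<Rightarrow> bool list" where
  "enc_rel n a R = map (\<lambda>t. t \<in> R) (product_lists (replicate a [0..<n]))"

definition enc_cst :: "nat \<Rightarrow> nat \<Rightarrow> bool list" where
  "enc_cst n c = rev (map (bit c) [0..<nat \<lceil>log 2 (real n)\<rceil>])"

definition enc :: "vocab \<Rightarrow> struct \<Rightarrow> bool list" where
  "enc \<sigma> A =
     concat (map2 (enc_rel (usize A)) (rel_arities \<sigma>) (rels A)) @
     concat (map (enc_cst (usize A)) (csts A))"


text \<open>
  \<open>FApp i\<close> applies the \<open>i\<close>-th free function variable; function variables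
  are the only function symbols of positive arity.
\<close>

datatype tm = Var nat | Cst nat | MinC | FApp nat "tm list"

datatype fm =
    Eq tm tm | Le tm tm | BIT tm tm | Rel nat "tm list"
  | Neg fm | Conj fm fm | Disj fm fm
  | Exists nat fm | Forall nat fm

text \<open>Well-formedness over \<open>\<sigma>\<close> and function variables of arities \<open>as\<close>.\<close>

fun wf_tm :: "vocab \<Rightarrow> nat list \<Rightarrow> tm \<Rightarrow> bool" where
  "wf_tm \<sigma> as (Var v) \<longleftrightarrow> True"
| "wf_tm \<sigma> as (Cst c) \<longleftrightarrow> c < num_csts \<sigma>"
| "wf_tm \<sigma> as MinC \<longleftrightarrow> True"
| "wf_tm \<sigma> as (FApp i ts) \<longleftrightarrow>
     i < length as \<and> length ts = as ! i \<and> (\<forall>t\<in>set ts. wf_tm \<sigma> as t)"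

fun wf_fm :: "vocab \<Rightarrow> nat list \<Rightarrow> fm \<Rightarrow> bool" where
  "wf_fm \<sigma> as (Eq s t) \<longleftrightarrow> wf_tm \<sigma> as s \<and> wf_tm \<sigma> as t"
| "wf_fm \<sigma> as (Le s t) \<longleftrightarrow> wf_tm \<sigma> as s \<and> wf_tm \<sigma> as t"
| "wf_fm \<sigma> as (BIT s t) \<longleftrightarrow> wf_tm \<sigma> as s \<and> wf_tm \<sigma> as t"
| "wf_fm \<sigma> as (Rel r ts) \<longleftrightarrow>
     r < length (rel_arities \<sigma>) \<and> length ts = rel_arities \<sigma> ! r \<and> (\<forall>t\<in>set ts. wf_tm \<sigma> as t)"
| "wf_fm \<sigma> as (Neg \<phi>) \<longleftrightarrow> wf_fm \<sigma> as \<phi>"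
| "wf_fm \<sigma> as (Conj \<phi> \<psi>) \<longleftrightarrow> wf_fm \<sigma> as \<phi> \<and> wf_fm \<sigma> as \<psi>"
| "wf_fm \<sigma> as (Disj \<phi> \<psi>) \<longleftrightarrow> wf_fm \<sigma> as \<phi> \<and> wf_fm \<sigma> as \<psi>"
| "wf_fm \<sigma> as (Exists v \<phi>) \<longleftrightarrow> wf_fm \<sigma> as \<phi>"
| "wf_fm \<sigma> as (Forall v \<phi>) \<longleftrightarrow> wf_fm \<sigma> as \<phi>"

fun fv_tm :: "tm \<Rightarrow> nat set" where
  "fv_tm (Var v) = {v}"
| "fv_tm (Cst c) = {}"
| "fv_tm MinC = {}"
| "fv_tm (FApp i ts) = (\<Union>t\<in>set ts. fv_tm t)"

fun fv :: "fm \<Rightarrow> nat set" where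
  "fv (Eq s t) = fv_tm s \<union> fv_tm t"
| "fv (Le s t) = fv_tm s \<union> fv_tm t"
| "fv (BIT s t) = fv_tm s \<union> fv_tm t"
| "fv (Rel r ts) = (\<Union>t\<in>set ts. fv_tm t)"
| "fv (Neg \<phi>) = fv \<phi>"
| "fv (Conj \<phi> \<psi>) = fv \<phi> \<union> fv \<psi>"
| "fv (Disj \<phi> \<psi>) = fv \<phi> \<union> fv \<psi>"
| "fv (Exists v \<phi>) = fv \<phi> - {v}"
| "fv (Forall v \<phi>) = fv \<phi> - {v}"

fun qfree :: "fm \<Rightarrow> bool" where
  "qfree (Exists v \<phi>) \<longleftrightarrow> False"
| "qfree (Forall v \<phi>) \<longleftrightarrow> False"
| "qfree (Neg \<phi>) \<longleftrightarrow> qfree \<phi>"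
| "qfree (Conj \<phi> \<psi>) \<longleftrightarrow> qfree \<phi> \<and> qfree \<psi>"
| "qfree (Disj \<phi> \<psi>) \<longleftrightarrow> qfree \<phi> \<and> qfree \<psi>"
| "qfree _ \<longleftrightarrow> True"

fun eval :: "struct \<Rightarrow> (nat list \<Rightarrow> nat) list \<Rightarrow> (nat \<Rightarrow> nat) \<Rightarrow> tm \<Rightarrow> nat" where
  "eval A fs e (Var v) = e v"
| "eval A fs e (Cst c) = csts A ! c"
| "eval A fs e MinC = 0"
| "eval A fs e (FApp i ts) = (fs ! i) (map (eval A fs e) ts)"

text \<open>\<open>BIT(i, j)\<close> says that bit \<open>i\<close> of \<open>j\<close> is 1, bit 0 being the least significant one.\<close>

fun sat :: "struct \<Rightarrow> (nat list \<Rightarrow> nat) list \<Rightarrow> (nat \<Rightarrow> nat) \<Rightarrow> fm \<Rightarrow> bool" where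
  "sat A fs e (Eq s t) \<longleftrightarrow> eval A fs e s = eval A fs e t"
| "sat A fs e (Le s t) \<longleftrightarrow> eval A fs e s \<le> eval A fs e t"
| "sat A fs e (BIT s t) \<longleftrightarrow> bit (eval A fs e t) (eval A fs e s)"
| "sat A fs e (Rel r ts) \<longleftrightarrow> map (eval A fs e) ts \<in> rels A ! r"
| "sat A fs e (Neg \<phi>) \<longleftrightarrow> \<not> sat A fs e \<phi>"
| "sat A fs e (Conj \<phi> \<psi>) \<longleftrightarrow> sat A fs e \<phi> \<and> sat A fs e \<psi>"
| "sat A fs e (Disj \<phi> \<psi>) \<longleftrightarrow> sat A fs e \<phi> \<or> sat A fs e \<psi>"
| "sat A fs e (Exists v \<phi>) \<longleftrightarrow> (\<exists>a\<in>universe A. sat A fs (e(v := a)) \<phi>)"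
| "sat A fs e (Forall v \<phi>) \<longleftrightarrow> (\<forall>a\<in>universe A. sat A fs (e(v := a)) \<phi>)"

text \<open>
  Tuples of functions of arities \<open>as\<close> on the universe. The functions are extensional, so that
  each function on the universe is counted exactly once.
\<close>

definition fun_tuples :: "struct \<Rightarrow> nat list \<Rightarrow> (nat list \<Rightarrow> nat) list set" where
  "fun_tuples A as = {fs. list_all2 (\<lambda>f a. f \<in> tuples (universe A) a \<rightarrow>\<^sub>E universe A) fs as}"


text \<open>
  The free individual variables \<open>x\<^sub>1, \<dots>, x\<^sub>l\<close> are the variables \<open>0, \<dots>, l - 1\<close>.
\<close>

definition sharp_Pi1 :: "(bool list \<Rightarrow> nat) set" where
  "sharp_Pi1 = {f. \<exists>\<sigma> as l \<phi> ys \<psi>.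
     vocabulary \<sigma> \<and> wf_fm \<sigma> as \<phi> \<and> fv \<phi> \<subseteq> {..<l} \<and>
     \<phi> = foldr Forall ys \<psi> \<and> qfree \<psi> \<and>
     (\<forall>A. is_struct \<sigma> A \<longrightarrow>
        f (enc \<sigma> A) =
          card {(fs, cs). fs \<in> fun_tuples A as \<and> cs \<in> tuples (universe A) l \<and>
                          sat A fs (\<lambda>j. cs ! j) \<phi>})}"

text \<open>
  \<open>skolem_prefix m 0 \<psi>\<close> is \<open>\<exists>y\<^sub>1 \<forall>z\<^sub>1 \<dots> \<exists>y\<^sub>m \<forall>z\<^sub>m \<exists>y\<^sub>k. \<psi>\<close> with \<open>k = m + 1\<close>, where
  \<open>y\<^sub>i\<close> is the variable \<open>2 * (i - 1)\<close> and \<open>z\<^sub>i\<close> is the variable \<open>2 * (i - 1) + 1\<close>.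
\<close>

fun skolem_prefix :: "nat \<Rightarrow> nat \<Rightarrow> fm \<Rightarrow> fm" where
  "skolem_prefix 0 v \<psi> = Exists v \<psi>"
| "skolem_prefix (Suc m) v \<psi> = Exists v (Forall (v + 1) (skolem_prefix m (v + 2) \<psi>))"

text \<open>The assignment \<open>y\<^sub>i \<mapsto> f\<^sub>i(z\<^sub>1, \<dots>, z\<^bsub>i-1\<^esub>)\<close>, \<open>z\<^sub>i \<mapsto> z\<^sub>i\<close>; the list \<open>fs\<close> is indexed from 0.\<close>

definition skolem_env :: "(nat list \<Rightarrow> nat) list \<Rightarrow> nat list \<Rightarrow> nat \<Rightarrow> nat" where
  "skolem_env fs zs v =
     (if even v then (fs ! (v div 2)) (take (v div 2) zs) else zs ! (v div 2))"

definition sharp_Pi1_Sk :: "(bool list \<Rightarrow> nat) set" where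
  "sharp_Pi1_Sk = {f. \<exists>\<sigma> m \<phi> \<psi>.
     vocabulary \<sigma> \<and> wf_fm \<sigma> [] \<phi> \<and> fv \<phi> = {} \<and>
     \<phi> = skolem_prefix m 0 \<psi> \<and> qfree \<psi> \<and>
     (\<forall>A. is_struct \<sigma> A \<longrightarrow>
        f (enc \<sigma> A) =
          card {fs \<in> fun_tuples A [0..<Suc m].
                \<forall>zs\<in>tuples (universe A) m. sat A [] (skolem_env fs zs) \<psi>})}"

end

theory Submission imports Defs "HOL-Library.Numeral_Type" begin

text \<open>
  For the inclusion, each existential variable \<open>y\<^sub>i\<close> becomes a function term applied to
  \<open>z\<^sub>1, \<dots>, z\<^bsub>i-1\<^esub>\<close>.

  For strictness, count the fixed-point free involutions of a unary relation: the count is positive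
  iff the relation has even size. A count of Skolem functions is positive iff the first-order
  sentence holds, so membership in \<open>sharp_Pi1_Sk\<close> would make parity first-order definable with
  arbitrary numerical predicates. The Razborov-Smolensky argument refutes this. A first-order
  formula agrees on most inputs with a polynomial over the three-element field of degree
  polylogarithmic in \<open>n\<close>. If a polynomial of degree \<open>d\<close> agrees with parity on \<open>S\<close>, then every
  function on \<open>S\<close> is a polynomial of degree \<open>n div 2 + d\<close>, because a character of a large set is
  parity times the character of its complement; counting functions against coefficient vectors
  bounds the size of \<open>S\<close>.
\<close>

subsection \<open>Multilinear polynomials on the cube\<close>

text \<open>A subset \<open>X\<close> of \<open>{..<n}\<close> is a 0/1 point, at which the monomial \<open>T\<close> is 1 iff \<open>T \<subseteq> X\<close>.\<close>

definition polys :: "nat \<Rightarrow> nat \<Rightarrow> (nat set \<Rightarrow> 'a::comm_ring_1) set" where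
  "polys n d = {p. \<exists>c. \<forall>X\<subseteq>{..<n}.
     p X = (\<Sum>T | T \<subseteq> {..<n} \<and> card T \<le> d. c T * of_bool (T \<subseteq> X))}"

lemma finite_monomials [simp]: "finite {T. T \<subseteq> {..<n::nat} \<and> P T}"
  by (rule finite_subset[of _ "Pow {..<n}"]) auto

lemma polys_cong:
  assumes "p \<in> polys n d" "\<And>X. X \<subseteq> {..<n} \<Longrightarrow> q X = p X"
  shows "q \<in> polys n d"
  using assms by (auto simp: polys_def)

lemma polys_monomial:
  assumes "T \<subseteq> {..<n}" "card T \<le> d"
  shows "(\<lambda>X. of_bool (T \<subseteq> X) :: 'a::comm_ring_1) \<in> polys n d"
proof -
  have "(of_bool (T \<subseteq> X) :: 'a) = (\<Sum>U | U \<subseteq> {..<n} \<and> card U \<le> d. of_bool (U = T) * of_bool (U \<subseteq> X))" for X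
  proof -
    have "(\<Sum>U | U \<subseteq> {..<n} \<and> card U \<le> d. of_bool (U = T) * of_bool (U \<subseteq> X))
        = (\<Sum>U | U \<subseteq> {..<n} \<and> card U \<le> d. if U = T then of_bool (T \<subseteq> X) else (0::'a))"
      by (intro sum.cong) auto
    also have "\<dots> = of_bool (T \<subseteq> X)"
      using assms by (subst sum.delta) auto
    finally show ?thesis by (rule sym)
  qed
  then show ?thesis
    unfolding polys_def mem_Collect_eq by (intro exI[of _ "\<lambda>U. of_bool (U = T)"]) blast
qed

lemma polys_add:
  assumes "p \<in> polys n d" "q \<in> polys n d"
  shows "(\<lambda>X. p X + q X) \<in> polys n d"
proof -
  obtain c where c: "\<forall>X\<subseteq>{..<n}. p X = (\<Sum>T | T \<subseteq> {..<n} \<and> card T \<le> d. c T * of_bool (T \<subseteq> X))"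
    using assms(1) unfolding polys_def by blast
  obtain c' where c': "\<forall>X\<subseteq>{..<n}. q X = (\<Sum>T | T \<subseteq> {..<n} \<and> card T \<le> d. c' T * of_bool (T \<subseteq> X))"
    using assms(2) unfolding polys_def by blast
  show ?thesis
    unfolding polys_def mem_Collect_eq
    by (rule exI[of _ "\<lambda>T. c T + c' T"]) (use c c' in \<open>simp add: distrib_right sum.distrib del: sum_mult_of_bool_eq sum_of_bool_mult_eq\<close>)
qed

lemma polys_smult:
  assumes "p \<in> polys n d"
  shows "(\<lambda>X. a * p X) \<in> polys n d"
proof -
  obtain c where c: "\<forall>X\<subseteq>{..<n}. p X = (\<Sum>T | T \<subseteq> {..<n} \<and> card T \<le> d. c T * of_bool (T \<subseteq> X))"
    using assms(1) unfolding polys_def by blast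
  show ?thesis
    unfolding polys_def mem_Collect_eq
    by (rule exI[of _ "\<lambda>T. a * c T"]) (use c in \<open>simp add: sum_distrib_left mult.assoc del: sum_mult_of_bool_eq sum_of_bool_mult_eq\<close>)
qed

lemma polys_const: "(\<lambda>X. a) \<in> polys n d"
  using polys_smult[OF polys_monomial[of "{}" n d], of a] by simp

lemma polys_diff:
  assumes "p \<in> polys n d" "q \<in> polys n d"
  shows "(\<lambda>X. p X - q X) \<in> polys n d"
  using polys_add[OF assms(1) polys_smult[OF assms(2), of "-1"]] by simp

lemma polys_sum:
  assumes "\<And>i. i \<in> I \<Longrightarrow> p i \<in> polys n d"
  shows "(\<lambda>X. \<Sum>i\<in>I. p i X) \<in> polys n d"
  using assms
  by (induction I rule: infinite_finite_induct) (auto intro: polys_const polys_add)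

lemma polys_mono:
  assumes "p \<in> polys n d" "d \<le> d'"
  shows "p \<in> polys n d'"
proof -
  obtain c where c: "\<forall>X\<subseteq>{..<n}. p X = (\<Sum>T | T \<subseteq> {..<n} \<and> card T \<le> d. c T * of_bool (T \<subseteq> X))"
    using assms(1) unfolding polys_def by blast
  have "(\<lambda>X. \<Sum>T | T \<subseteq> {..<n} \<and> card T \<le> d. c T * of_bool (T \<subseteq> X)) \<in> polys n d'"
    using assms(2) by (intro polys_sum polys_smult polys_monomial) auto
  then show ?thesis
    by (rule polys_cong) (use c in \<open>simp del: sum_mult_of_bool_eq sum_of_bool_mult_eq\<close>)
qed

text \<open>Coordinates are idempotent at 0/1 points, so the product of the monomials
  \<open>T\<close> and \<open>U\<close> is the monomial \<open>T \<union> U\<close>, whose degree is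
  at most \<open>d + d'\<close>.\<close>

lemma polys_mult:
  assumes "p \<in> polys n d" "q \<in> polys n d'"
  shows "(\<lambda>X. p X * q X) \<in> polys n (d + d')"
proof -
  obtain c where c: "\<forall>X\<subseteq>{..<n}. p X = (\<Sum>T | T \<subseteq> {..<n} \<and> card T \<le> d. c T * of_bool (T \<subseteq> X))"
    using assms(1) unfolding polys_def by blast
  obtain c' where c': "\<forall>X\<subseteq>{..<n}. q X = (\<Sum>T | T \<subseteq> {..<n} \<and> card T \<le> d'. c' T * of_bool (T \<subseteq> X))"
    using assms(2) unfolding polys_def by blast
  have "(\<lambda>X. \<Sum>T | T \<subseteq> {..<n} \<and> card T \<le> d. \<Sum>U | U \<subseteq> {..<n} \<and> card U \<le> d'.
      (c T * c' U) * of_bool (T \<union> U \<subseteq> X)) \<in> polys n (d + d')"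
    by (intro polys_sum polys_smult polys_monomial)
      (auto intro: order.trans[OF card_Un_le])
  then show ?thesis
  proof (rule polys_cong)
    fix X assume X: "X \<subseteq> {..<n}"
    show "p X * q X = (\<Sum>T | T \<subseteq> {..<n} \<and> card T \<le> d. \<Sum>U | U \<subseteq> {..<n} \<and> card U \<le> d'.
      (c T * c' U) * of_bool (T \<union> U \<subseteq> X))"
      unfolding c[rule_format, OF X] c'[rule_format, OF X] sum_product
      by (intro sum.cong refl) simp
  qed
qed

lemma polys_prod:
  assumes "finite I" "\<And>i. i \<in> I \<Longrightarrow> p i \<in> polys n d"
  shows "(\<lambda>X. \<Prod>i\<in>I. p i X) \<in> polys n (card I * d)"
  using assms
proof (induction I rule: finite_induct)
  case empty
  then show ?case by (simp add: polys_const)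
next
  case (insert i I)
  then have "(\<lambda>X. p i X * (\<Prod>i\<in>I. p i X)) \<in> polys n (d + card I * d)"
    by (intro polys_mult) auto
  with insert show ?case by simp
qed

subsection \<open>Parity is far from low-degree polynomials\<close>

text \<open>The change of variable 1 - 2 x_i from 0/1 to signs; products of
  \<open>cube_sign i\<close> over a set of coordinates are the characters of the cube.\<close>

definition cube_sign :: "nat \<Rightarrow> nat set \<Rightarrow> 'a::comm_ring_1" where
  "cube_sign i X = (if i \<in> X then -1 else 1)"

lemma cube_sign_in_polys: "i < n \<Longrightarrow> cube_sign i \<in> polys n 1"
  by (rule polys_cong[OF polys_diff[OF polys_const[of 1] polys_smult[OF polys_monomial[of "{i}"], of _ _ 2]]])
    (auto simp: cube_sign_def)

lemma prod_cube_sign: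
  assumes "X \<subseteq> {..<n}"
  shows "(\<Prod>i<n. cube_sign i X) = (-1) ^ card X"
proof -
  have "(\<Prod>i<n. cube_sign i X) = (\<Prod>i\<in>X. -1) * (\<Prod>i\<in>{..<n} - X. (1::'a))"
    using assms by (subst prod.subset_diff[of X]) (auto simp: cube_sign_def mult.commute intro!: arg_cong2[where f="(*)"] prod.cong)
  then show ?thesis by simp
qed

lemma elem3_cases: "(x::3) = 0 \<or> x = 1 \<or> x = -1"
proof -
  have "x \<in> (UNIV :: 3 set)" by simp
  moreover have "card {0, 1, -1 :: 3} = 3" by simp
  then have "{0, 1, -1} = (UNIV :: 3 set)" by (intro card_subset_eq) auto
  ultimately show ?thesis by blast
qed

text \<open>Fermat's little theorem for the prime 3: squaring turns a field element into a zero test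
  and only doubles the degree.\<close>

lemma square3: "(x::3) \<noteq> 0 \<Longrightarrow> x\<^sup>2 = 1"
  using elem3_cases[of x] by auto

text \<open>For signs a and x the factor -1 - a x is -2 = 1 if a = x, and 0 otherwise. It is the
  familiar (1 + a x) / 2, since 1/2 = -1 in characteristic 3.\<close>

lemma of_bool_eq_prod_cube_sign:
  assumes "X \<subseteq> {..<n}" "A \<subseteq> {..<n}"
  shows "of_bool (X = A) = (\<Prod>i<n. (-1) + (- cube_sign i A) * cube_sign i X :: 3)"
proof (cases "X = A")
  case True
  have "- 1 + (- cube_sign i A) * cube_sign i A = (1::3)" for i
    by (simp add: cube_sign_def)
  with True show ?thesis by simp
next
  case False
  then obtain i where "i < n" "i \<in> X \<longleftrightarrow> i \<notin> A" using assms by blast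
  then have "(\<Prod>i<n. (-1) + (- cube_sign i A) * cube_sign i X :: 3) = 0"
    by (intro prod_zero) (auto simp: cube_sign_def intro!: bexI[of _ i])
  with False show ?thesis by simp
qed

text \<open>On \<open>S\<close> every character has a representative of degree at most
  \<open>n div 2 + d\<close>: itself if its set is small, \<open>p\<close> times the complementary
  character otherwise. Point indicators expand into characters, so interpolation extends this to
  every \<open>g\<close>.\<close>

lemma polys_on_agreement_set:
  fixes p g :: "nat set \<Rightarrow> 3"
  assumes p: "p \<in> polys n d" and S: "S \<subseteq> Pow {..<n}"
    and agree: "\<And>X. X \<in> S \<Longrightarrow> p X = (-1) ^ card X"
  shows "\<exists>q\<in>polys n (n div 2 + d). \<forall>X\<in>S. q X = g X"
proof -
  let ?D = "n div 2 + d"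
  have fS: "finite S" using S by (rule finite_subset) simp
  have "\<exists>q\<in>polys n ?D. \<forall>X\<in>S. q X = (\<Prod>i\<in>T. cube_sign i X :: 3)" if T: "T \<subseteq> {..<n}" for T
  proof (cases "card T \<le> n div 2")
    case True
    have "(\<lambda>X. \<Prod>i\<in>T. cube_sign i X) \<in> polys n (card T * 1)"
      using T by (intro polys_prod cube_sign_in_polys) (auto intro: finite_subset)
    then show ?thesis
      using True by (intro bexI[of _ "\<lambda>X. \<Prod>i\<in>T. cube_sign i X"]) (auto elim: polys_mono)
  next
    case False
    let ?C = "{..<n} - T"
    have fT: "finite T" using T by (rule finite_subset) simp
    have cC: "card ?C \<le> n div 2"
      using False T fT by (simp add: card_Diff_subset)
    have "(\<lambda>X. \<Prod>i\<in>?C. cube_sign i X) \<in> polys n (card ?C * 1)"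
      by (intro polys_prod cube_sign_in_polys) auto
    then have "(\<lambda>X. p X * (\<Prod>i\<in>?C. cube_sign i X)) \<in> polys n ?D"
      using cC by (auto intro: polys_mono[OF polys_mult[OF p]])
    moreover have "p X * (\<Prod>i\<in>?C. cube_sign i X) = (\<Prod>i\<in>T. cube_sign i X)" if "X \<in> S" for X
    proof -
      have "p X = (\<Prod>i<n. cube_sign i X)"
      proof -
        have "X \<subseteq> {..<n}" using that S by blast
        then show ?thesis by (simp only: agree[OF that] prod_cube_sign)
      qed
      also have "\<dots> = (\<Prod>i\<in>?C. cube_sign i X) * (\<Prod>i\<in>T. cube_sign i X)"
        using T by (intro prod.subset_diff) auto
      finally have "p X * (\<Prod>i\<in>?C. cube_sign i X) = (\<Prod>i\<in>?C. cube_sign i X * cube_sign i X) * (\<Prod>i\<in>T. cube_sign i X)"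
        by (simp add: prod.distrib mult_ac)
      \<comment> \<open>Signs square to 1, so multiplying parity by the complementary character
        cancels all coordinates outside \<open>T\<close>.\<close>
      also have "(\<Prod>i\<in>?C. cube_sign i X * cube_sign i X) = (1::3)"
        by (intro prod.neutral) (simp add: cube_sign_def)
      finally show ?thesis by simp
    qed
    ultimately show ?thesis
      by (intro bexI[of _ "\<lambda>X. p X * (\<Prod>i\<in>?C. cube_sign i X)"] ballI)
  qed
  then obtain Q where Q: "\<And>T. T \<subseteq> {..<n} \<Longrightarrow> Q T \<in> polys n ?D"
    "\<And>T X. T \<subseteq> {..<n} \<Longrightarrow> X \<in> S \<Longrightarrow> Q T X = (\<Prod>i\<in>T. cube_sign i X :: 3)"
    by metis
  \<comment> \<open>Lagrange interpolation over \<open>S\<close>. Multiplying out the indicator of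
    \<open>A\<close> gives one term for each set \<open>B\<close> of factors that contribute their
    constant -1; the remaining factors form the character of \<open>{..<n} - B\<close>, which
    \<open>Q\<close> replaces.\<close>
  define q where "q = (\<lambda>X. \<Sum>A\<in>S. g A * (\<Sum>B\<in>Pow {..<n}.
      ((\<Prod>i\<in>B. -1) * (\<Prod>i\<in>{..<n} - B. - cube_sign i A)) * Q ({..<n} - B) X))"
  have "q \<in> polys n ?D"
    unfolding q_def by (intro polys_sum polys_smult Q) auto
  moreover have "q X = g X" if X: "X \<in> S" for X
  proof -
    have "(\<Sum>B\<in>Pow {..<n}. ((\<Prod>i\<in>B. -1) * (\<Prod>i\<in>{..<n} - B. - cube_sign i A)) * Q ({..<n} - B) X)
        = of_bool (X = A)" if A: "A \<in> S" for A
    proof -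
      have "of_bool (X = A) = (\<Prod>i<n. (-1) + (- cube_sign i A) * cube_sign i X :: 3)"
        using X A S by (intro of_bool_eq_prod_cube_sign) auto
      also have "\<dots> = (\<Sum>B\<in>Pow {..<n}. (\<Prod>i\<in>B. -1) * (\<Prod>i\<in>{..<n} - B. (- cube_sign i A) * cube_sign i X))"
        by (intro prod_add) simp
      also have "\<dots> = (\<Sum>B\<in>Pow {..<n}. ((\<Prod>i\<in>B. -1) * (\<Prod>i\<in>{..<n} - B. - cube_sign i A)) * Q ({..<n} - B) X)"
        by (intro sum.cong refl) (subst Q(2), use X in \<open>auto simp only: prod.distrib mult_ac\<close>)
      finally show ?thesis by simp
    qed
    then have "q X = (\<Sum>A\<in>S. g A * of_bool (X = A))"
      unfolding q_def by (intro sum.cong) auto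
    also have "\<dots> = g X"
      using X fS by (simp add: of_bool_def if_distrib[of "\<lambda>x. _ * x"] sum.delta cong: if_cong)
    finally show ?thesis .
  qed
  ultimately show ?thesis by (intro bexI[of _ q] ballI)
qed

text \<open>Evaluation on \<open>S\<close> maps the coefficient vectors indexed by \<open>?M\<close>
  onto all functions from \<open>S\<close> to the field, hence 3 ^ \<open>card S\<close> \<le> 3 ^
  \<open>card ?M\<close>. Extensional functions keep both sides finite.\<close>

lemma agreement_set_card_le:
  fixes p :: "nat set \<Rightarrow> 3"
  assumes p: "p \<in> polys n d" and S: "S \<subseteq> Pow {..<n}"
    and agree: "\<And>X. X \<in> S \<Longrightarrow> p X = (-1) ^ card X"
  shows "card S \<le> card {T. T \<subseteq> {..<n} \<and> card T \<le> n div 2 + d}"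
proof -
  let ?M = "{T. T \<subseteq> {..<n} \<and> card T \<le> n div 2 + d}"
  let ?ev = "\<lambda>c. restrict (\<lambda>X. \<Sum>T\<in>?M. c T * of_bool (T \<subseteq> X)) S"
  have fS: "finite S" using S by (rule finite_subset) simp
  have "(S \<rightarrow>\<^sub>E (UNIV::3 set)) \<subseteq> ?ev ` (?M \<rightarrow>\<^sub>E UNIV)"
  proof
    fix g assume g: "g \<in> S \<rightarrow>\<^sub>E (UNIV::3 set)"
    obtain q where q: "q \<in> polys n (n div 2 + d)" "\<forall>X\<in>S. q X = g X"
      using polys_on_agreement_set[OF p S agree] by blast
    then obtain c where c: "\<forall>X\<subseteq>{..<n}. q X = (\<Sum>T\<in>?M. c T * of_bool (T \<subseteq> X))"
      unfolding polys_def by blast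
    have "g = ?ev (restrict c ?M)"
    proof
      fix X
      show "g X = ?ev (restrict c ?M) X"
      proof (cases "X \<in> S")
        case True
        then have "X \<subseteq> {..<n}" using S by blast
        then have "(\<Sum>T\<in>?M. c T * of_bool (T \<subseteq> X)) = g X"
          using True c[rule_format, of X] q(2)[rule_format, of X] by simp
        moreover have "(\<Sum>T\<in>?M. c T * of_bool (T \<subseteq> X)) = (\<Sum>T\<in>?M. restrict c ?M T * of_bool (T \<subseteq> X))"
          by (intro sum.cong refl) simp
        ultimately show ?thesis using True by (simp only: restrict_apply' if_True)
      next
        case False
        then show ?thesis using g by auto
      qed
    qed
    then show "g \<in> ?ev ` (?M \<rightarrow>\<^sub>E UNIV)" by (intro image_eqI[where x="restrict c ?M"]) auto
  qed
  then have "card (S \<rightarrow>\<^sub>E (UNIV::3 set)) \<le> card (?M \<rightarrow>\<^sub>E (UNIV::3 set))"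
    by (rule surj_card_le[rotated]) (intro finite_PiE, auto)
  then have "(3::nat) ^ card S \<le> 3 ^ card ?M"
    using fS by (simp add: card_PiE)
  then show ?thesis by simp
qed

section \<open>Sizes of the layers of the cube and the resulting degree bound\<close>

lemma central_binomial_Suc:
  "Suc m * ((2 * Suc m) choose Suc m) = 2 * (2 * m + 1) * ((2 * m) choose m)"
proof -
  define x where "x = Suc (2 * m) choose m"
  have "Suc m * (Suc (Suc (2 * m)) choose Suc m) = Suc m * (2 * x)"
    unfolding x_def by (subst Suc_times_binomial) simp
  then have "Suc (Suc (2 * m)) choose Suc m = 2 * x" by (simp only: mult_cancel1) auto
  moreover have "x = Suc (2 * m) choose Suc m"
    unfolding x_def by (subst binomial_symmetric) auto
  then have "Suc m * x = Suc (2 * m) * ((2 * m) choose m)"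
    by (simp only: Suc_times_binomial)
  ultimately show ?thesis by (simp add: algebra_simps)
qed

text \<open>This is the bound 4^m / sqrt (2 m + 1), squared to stay within the natural numbers. The
  induction step reduces to (2 m + 1) (2 m + 3) \<le> 4 (m + 1)^2.\<close>

lemma central_binomial_upper: "((2 * m) choose m)\<^sup>2 * (2 * m + 1) \<le> 16 ^ m"
proof (induction m)
  case (Suc m)
  let ?b = "(2 * m) choose m" and ?c = "(2 * Suc m) choose Suc m"
  have "(Suc m)\<^sup>2 * (?c\<^sup>2 * (2 * Suc m + 1)) = (Suc m * ?c)\<^sup>2 * (2 * m + 3)"
    by (simp only: power_mult_distrib) (simp add: algebra_simps del: binomial_Suc_Suc)
  also have "\<dots> = (?b\<^sup>2 * (2 * m + 1)) * (4 * (2 * m + 1) * (2 * m + 3))"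
    unfolding central_binomial_Suc by (simp only: power2_eq_square ac_simps)
  also have "\<dots> \<le> 16 ^ m * ((Suc m)\<^sup>2 * 16)"
    by (rule mult_mono[OF Suc.IH]) (auto simp: power2_eq_square algebra_simps)
  finally have "(Suc m)\<^sup>2 * (?c\<^sup>2 * (2 * Suc m + 1)) \<le> (Suc m)\<^sup>2 * 16 ^ Suc m"
    by (simp only: power_Suc ac_simps)
  then show ?case by (simp only: mult_le_cancel1) simp
qed simp

text \<open>Complementation injects the layers below the middle into those above it, so the former
  hold at most half of the cube. Each of the d + 1 layers from m to m + d has at most the size of
  the middle one.\<close>

lemma card_low_degree_monomials:
  "2 * card {T. T \<subseteq> {..<2 * m} \<and> card T \<le> m + d} \<le> 4 ^ m + 2 * (d + 1) * ((2 * m) choose m)"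
proof -
  let ?L = "{T. T \<subseteq> {..<2 * m} \<and> card T < m}"
  let ?H = "{T. T \<subseteq> {..<2 * m} \<and> m < card T}"
  let ?E = "\<lambda>k. {T. T \<subseteq> {..<2 * m} \<and> card T = k}"
  let ?b = "(2 * m) choose m"
  have "card (\<Union>k\<in>{m..m + d}. ?E k) \<le> (\<Sum>k\<in>{m..m + d}. card (?E k))"
    by (rule card_UN_le) simp
  also have "\<dots> \<le> (\<Sum>k\<in>{m..m + d}. ?b)"
    by (intro sum_mono) (simp add: n_subsets binomial_maximum')
  finally have B: "card (\<Union>k\<in>{m..m + d}. ?E k) \<le> (d + 1) * ?b" by simp
  have "card ?L \<le> card ?H"
  proof (rule card_inj_on_le[of "\<lambda>T. {..<2 * m} - T"])
    show "inj_on (\<lambda>T. {..<2 * m} - T) ?L" by (rule inj_onI) blast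
    show "(\<lambda>T. {..<2 * m} - T) ` ?L \<subseteq> ?H"
      by (auto simp: card_Diff_subset finite_subset)
  qed simp
  moreover have "card ?L + card ?H = card (?L \<union> ?H)"
    by (rule card_Un_disjoint[symmetric]) auto
  moreover have "card (?L \<union> ?H) \<le> card (Pow {..<2 * m})"
    by (rule card_mono) auto
  moreover have "card (Pow {..<2 * m}) = 4 ^ m"
    by (simp add: card_Pow power_mult)
  ultimately have L: "2 * card ?L \<le> 4 ^ m" by linarith
  have "{T. T \<subseteq> {..<2 * m} \<and> card T \<le> m + d} \<subseteq> ?L \<union> (\<Union>k\<in>{m..m + d}. ?E k)" by auto
  then have "card {T. T \<subseteq> {..<2 * m} \<and> card T \<le> m + d} \<le> card (?L \<union> (\<Union>k\<in>{m..m + d}. ?E k))"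
    by (intro card_mono) auto
  also have "\<dots> \<le> card ?L + card (\<Union>k\<in>{m..m + d}. ?E k)" by (rule card_Un_le)
  finally have "card {T. T \<subseteq> {..<2 * m} \<and> card T \<le> m + d} \<le> card ?L + (d + 1) * ?b"
    using B by linarith
  with L have "2 * card {T. T \<subseteq> {..<2 * m} \<and> card T \<le> m + d} \<le> 4 ^ m + 2 * ((d + 1) * ?b)"
    by linarith
  then show ?thesis by (simp only: mult.assoc)
qed

text \<open>Agreement on three quarters of the cube exceeds the half coming from the lower layers,
  so the middle layers must supply the rest: 4^m \<le> 4 (d + 1) binom(2 m, m). By the central
  binomial bound, d is at least of order sqrt m.\<close>

lemma even_card_not_approximable:
  fixes p :: "nat set \<Rightarrow> 3"
  assumes p: "p \<in> polys (2 * m) d"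
    and few: "4 * card {X. X \<subseteq> {..<2 * m} \<and> p X \<noteq> of_bool (even (card X))} \<le> 4 ^ m"
  shows "2 * m + 1 \<le> 16 * (d + 1)\<^sup>2"
proof -
  let ?S = "{X. X \<subseteq> {..<2 * m} \<and> p X = of_bool (even (card X))}"
  let ?B = "{X. X \<subseteq> {..<2 * m} \<and> p X \<noteq> of_bool (even (card X))}"
  let ?b = "(2 * m) choose m"
  have "card ?S \<le> card {T. T \<subseteq> {..<2 * m} \<and> card T \<le> (2 * m) div 2 + d}"
  proof (rule agreement_set_card_le)
    \<comment> \<open>The affine map 2 y - 1 turns the 0/1 indicator of even size into the sign (-1)
      ^ \<open>card X\<close> without raising the degree.\<close>
    show "(\<lambda>X. 2 * p X - 1) \<in> polys (2 * m) d"
      by (intro polys_diff polys_smult p polys_const)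
  qed auto
  then have 1: "2 * card ?S \<le> 4 ^ m + 2 * (d + 1) * ?b"
    using card_low_degree_monomials[of m d] by simp
  have "card ?S + card ?B = card (?S \<union> ?B)"
    by (rule card_Un_disjoint[symmetric]) auto
  also have "?S \<union> ?B = Pow {..<2 * m}" by auto
  finally have "card ?S + card ?B = 4 ^ m"
    by (simp add: card_Pow power_mult)
  with 1 few have "4 ^ m \<le> 4 * (d + 1) * ?b" by (simp add: algebra_simps)
  then have "(4 ^ m)\<^sup>2 \<le> (4 * (d + 1) * ?b)\<^sup>2" by (rule power_mono) simp
  moreover have "(4 ^ m)\<^sup>2 = (16::nat) ^ m"
    by (simp only: power2_eq_square power_mult_distrib[symmetric]) simp
  moreover have "(4 * (d + 1) * ?b)\<^sup>2 = 16 * (d + 1)\<^sup>2 * ?b\<^sup>2"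
    by (simp only: power_mult_distrib) simp
  ultimately have "16 ^ m \<le> 16 * (d + 1)\<^sup>2 * ?b\<^sup>2" by (simp only:)
  then have "16 ^ m * (2 * m + 1) \<le> (16 * (d + 1)\<^sup>2 * ?b\<^sup>2) * (2 * m + 1)"
    by (rule mult_right_mono) simp
  also have "\<dots> = 16 * (d + 1)\<^sup>2 * (?b\<^sup>2 * (2 * m + 1))" by (simp only: mult.assoc)
  also have "\<dots> \<le> 16 * (d + 1)\<^sup>2 * 16 ^ m"
    by (intro mult_left_mono central_binomial_upper) simp
  finally have "16 ^ m * (2 * m + 1) \<le> 16 ^ m * (16 * (d + 1)\<^sup>2)" by (simp only: mult_ac)
  then show ?thesis by (simp only: mult_le_cancel1) simp
qed

subsection \<open>Approximation by low-degree polynomials\<close>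

text \<open>If some entry \<open>v X a\<close> is nonzero, a uniformly random subset of
  \<open>I\<close> has sum zero with probability at most 1/2. Averaging over \<open>X\<close> yields
  one subset that is good for at least half of \<open>B\<close>.\<close>

lemma exists_halving_subset:
  fixes v :: "'b \<Rightarrow> 'i \<Rightarrow> 'a::ab_group_add"
  assumes "finite B" "finite I" and nz: "\<And>X. X \<in> B \<Longrightarrow> \<exists>i\<in>I. v X i \<noteq> 0"
  shows "\<exists>S\<subseteq>I. 2 * card {X\<in>B. (\<Sum>i\<in>S. v X i) = 0} \<le> card B"
proof (rule ccontr)
  assume "\<not> ?thesis"
  then have gt: "card B < 2 * card {X\<in>B. (\<Sum>i\<in>S. v X i) = 0}" if "S \<in> Pow I" for S
    using that by (auto simp: not_le)
  have half: "2 * card {S\<in>Pow I. (\<Sum>i\<in>S. v X i) = 0} \<le> card (Pow I)" if X: "X \<in> B" for X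
  proof -
    obtain a where a: "a \<in> I" "v X a \<noteq> 0" using nz[OF X] by blast
    let ?Z = "{S\<in>Pow I. (\<Sum>i\<in>S. v X i) = 0}" and ?N = "{S\<in>Pow I. (\<Sum>i\<in>S. v X i) \<noteq> 0}"
    \<comment> \<open>Toggling membership of \<open>a\<close> changes the sum by
      \<open>v X a\<close>, up to sign, so it maps zero-sum subsets injectively to subsets with
      nonzero sum.\<close>
    let ?t = "\<lambda>S. if a \<in> S then S - {a} else insert a S"
    have "card ?Z \<le> card ?N"
    proof (rule card_inj_on_le[of ?t])
      show "inj_on ?t ?Z"
        by (rule inj_onI) (auto split: if_splits)
      show "?t ` ?Z \<subseteq> ?N"
      proof
        fix T assume "T \<in> ?t ` ?Z"
        then obtain S where S: "S \<subseteq> I" "(\<Sum>i\<in>S. v X i) = 0" "T = ?t S" by auto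
        have fS: "finite S" using S(1) assms(2) by (rule finite_subset)
        have "(\<Sum>i\<in>T. v X i) \<noteq> 0"
        proof (cases "a \<in> S")
          case True
          then have "(\<Sum>i\<in>S. v X i) = v X a + (\<Sum>i\<in>T. v X i)"
            using S(3) fS by (simp add: sum.remove)
          then show ?thesis using S(2) a(2) by auto
        next
          case False
          then show ?thesis using S fS a(2) by simp
        qed
        moreover have "T \<subseteq> I" using S a by auto
        ultimately show "T \<in> ?N" by simp
      qed
    qed (use assms(2) in simp)
    moreover have "card ?Z + card ?N = card (?Z \<union> ?N)"
      using assms(2) by (intro card_Un_disjoint[symmetric]) auto
    moreover have "?Z \<union> ?N = Pow I" by blast
    ultimately show ?thesis by simp
  qed
  \<comment> \<open>Double counting of the pairs of a subset \<open>S\<close> and a point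
    \<open>X\<close> with vanishing sum.\<close>
  have "card (Pow I) * card B = (\<Sum>S\<in>Pow I. card B)" by simp
  also have "\<dots> < (\<Sum>S\<in>Pow I. 2 * card {X\<in>B. (\<Sum>i\<in>S. v X i) = 0})"
    using assms(2) gt by (intro sum_strict_mono) auto
  also have "\<dots> = 2 * (\<Sum>S\<in>Pow I. \<Sum>X\<in>B. of_bool ((\<Sum>i\<in>S. v X i) = 0))"
    using assms(1) by (simp add: sum_distrib_left Int_def)
  also have "\<dots> = (\<Sum>X\<in>B. 2 * (\<Sum>S\<in>Pow I. of_bool ((\<Sum>i\<in>S. v X i) = 0)))"
    by (subst sum.swap) (simp only: sum_distrib_left)
  also have "\<dots> = (\<Sum>X\<in>B. 2 * card {S\<in>Pow I. (\<Sum>i\<in>S. v X i) = 0})"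
    using assms(2) by (simp add: Int_def)
  also have "\<dots> \<le> (\<Sum>X\<in>B. card (Pow I))"
    by (intro sum_mono half)
  finally show False by simp
qed

text \<open>Here \<open>u\<close> imitates the NOR of the \<open>p i\<close>. It never errs where
  all of them vanish; each of the \<open>t\<close> rounds multiplies it by a factor of degree
  \<open>2 * d\<close> that at least halves the set of remaining errors.\<close>

lemma greedy_or_polynomial:
  fixes p :: "'i \<Rightarrow> nat set \<Rightarrow> 3"
  assumes "finite I" and p: "\<And>i. i \<in> I \<Longrightarrow> p i \<in> polys n d"
  shows "\<exists>u\<in>(polys n (2 * t * d) :: (nat set \<Rightarrow> 3) set).
    (\<forall>X. (\<forall>i\<in>I. p i X = 0) \<longrightarrow> u X = 1) \<and>
    2 ^ t * card {X. X \<subseteq> {..<n} \<and> (\<exists>i\<in>I. p i X \<noteq> 0) \<and> u X \<noteq> 0} \<le> 2 ^ n"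
proof (induction t)
  case 0
  have "card {X. X \<subseteq> {..<n} \<and> (\<exists>i\<in>I. p i X \<noteq> 0)} \<le> card (Pow {..<n})"
    by (intro card_mono) auto
  then show ?case
    by (intro bexI[of _ "\<lambda>X. 1"]) (auto simp: card_Pow polys_const)
next
  case (Suc t)
  from Suc.IH obtain u :: "nat set \<Rightarrow> 3" where u: "u \<in> polys n (2 * t * d)"
    "(\<forall>X. (\<forall>i\<in>I. p i X = 0) \<longrightarrow> u X = 1) \<and>
     2 ^ t * card {X. X \<subseteq> {..<n} \<and> (\<exists>i\<in>I. p i X \<noteq> 0) \<and> u X \<noteq> 0} \<le> 2 ^ n" by (rule bexE)
  note u = u(1) u(2)[THEN conjunct1, rule_format] u(2)[THEN conjunct2]
  let ?B = "{X. X \<subseteq> {..<n} \<and> (\<exists>i\<in>I. p i X \<noteq> 0) \<and> u X \<noteq> 0}"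
  have "\<exists>S\<subseteq>I. 2 * card {X\<in>?B. (\<Sum>i\<in>S. p i X) = 0} \<le> card ?B"
  proof (rule exists_halving_subset)
    show "\<exists>i\<in>I. p i X \<noteq> 0" if "X \<in> ?B" for X using that by blast
  qed (use assms(1) in simp_all)
  then obtain S where S: "S \<subseteq> I" "2 * card {X\<in>?B. (\<Sum>i\<in>S. p i X) = 0} \<le> card ?B"
    by blast
  \<comment> \<open>By \<open>square3\<close> the new factor is 0 where the subset sum is nonzero
    and 1 where it is zero. Old errors with a nonzero sum are thus repaired, and no new ones
    arise.\<close>
  define w where "w X = u X * (1 - (\<Sum>i\<in>S. p i X) * (\<Sum>i\<in>S. p i X))" for X
  have "w \<in> polys n (2 * t * d + (d + d))"
    unfolding w_def using S(1)
    by (intro polys_mult u polys_diff polys_const polys_sum p) auto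
  then have "w \<in> polys n (2 * Suc t * d)" by (simp add: algebra_simps)
  moreover have "w X = 1" if "\<forall>i\<in>I. p i X = 0" for X
  proof -
    have "(\<Sum>i\<in>S. p i X) = 0" using S(1) that by (intro sum.neutral) auto
    then show ?thesis unfolding w_def using u(2)[OF that[rule_format]] by simp
  qed
  moreover have "2 ^ Suc t * card {X. X \<subseteq> {..<n} \<and> (\<exists>i\<in>I. p i X \<noteq> 0) \<and> w X \<noteq> 0} \<le> 2 ^ n"
  proof -
    have "{X. X \<subseteq> {..<n} \<and> (\<exists>i\<in>I. p i X \<noteq> 0) \<and> w X \<noteq> 0} \<subseteq> {X\<in>?B. (\<Sum>i\<in>S. p i X) = 0}"
    proof
      fix X assume X: "X \<in> {X. X \<subseteq> {..<n} \<and> (\<exists>i\<in>I. p i X \<noteq> 0) \<and> w X \<noteq> 0}"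
      then have "u X \<noteq> 0" "(\<Sum>i\<in>S. p i X)\<^sup>2 \<noteq> 1"
        unfolding w_def power2_eq_square by auto
      then show "X \<in> {X\<in>?B. (\<Sum>i\<in>S. p i X) = 0}" using X square3 by auto
    qed
    then have "card {X. X \<subseteq> {..<n} \<and> (\<exists>i\<in>I. p i X \<noteq> 0) \<and> w X \<noteq> 0}
        \<le> card {X\<in>?B. (\<Sum>i\<in>S. p i X) = 0}"
      by (intro card_mono) auto
    with S(2) have "2 * card {X. X \<subseteq> {..<n} \<and> (\<exists>i\<in>I. p i X \<noteq> 0) \<and> w X \<noteq> 0} \<le> card ?B"
      by linarith
    then have "2 ^ t * (2 * card {X. X \<subseteq> {..<n} \<and> (\<exists>i\<in>I. p i X \<noteq> 0) \<and> w X \<noteq> 0}) \<le> 2 ^ t * card ?B"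
      by (rule mult_left_mono) simp
    with u(3) show ?thesis by (simp only: power_Suc mult_ac)
  qed
  ultimately show ?case by (intro bexI[of _ w] conjI allI impI)
qed

text \<open>\<open>b\<close> bounds the number of errors in units of \<open>2 ^ n / 2 ^ t\<close>.\<close>

definition approximable :: "nat \<Rightarrow> nat \<Rightarrow> nat \<Rightarrow> nat \<Rightarrow> (nat set \<Rightarrow> bool) \<Rightarrow> bool" where
  "approximable n t d b F \<longleftrightarrow> (\<exists>p\<in>(polys n d :: (nat set \<Rightarrow> 3) set).
     2 ^ t * card {X. X \<subseteq> {..<n} \<and> p X \<noteq> of_bool (F X)} \<le> b * 2 ^ n)"

section \<open>Closure properties of approximability\<close>

lemma approximable_mono:
  assumes "approximable n t d b F" "d \<le> d'" "b \<le> b'"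
  shows "approximable n t d' b' F"
proof -
  obtain p :: "nat set \<Rightarrow> 3" where p: "p \<in> polys n d"
    "2 ^ t * card {X. X \<subseteq> {..<n} \<and> p X \<noteq> of_bool (F X)} \<le> b * 2 ^ n"
    using assms(1) unfolding approximable_def by blast
  have "b * 2 ^ n \<le> b' * 2 ^ n" using assms(3) by simp
  with p(2) have "2 ^ t * card {X. X \<subseteq> {..<n} \<and> p X \<noteq> of_bool (F X)} \<le> b' * 2 ^ n"
    by linarith
  with polys_mono[OF p(1) assms(2)] show ?thesis
    unfolding approximable_def by blast
qed

lemma approximable_exact:
  assumes "(\<lambda>X. of_bool (F X)) \<in> (polys n d :: (nat set \<Rightarrow> 3) set)"
  shows "approximable n t d b F"
  using assms unfolding approximable_def by (intro bexI[of _ "\<lambda>X. of_bool (F X)"]) auto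

lemma approximable_cong:
  assumes "approximable n t d b F" "\<And>X. X \<subseteq> {..<n} \<Longrightarrow> G X = F X"
  shows "approximable n t d b G"
proof -
  have "{X. X \<subseteq> {..<n} \<and> p X \<noteq> of_bool (F X)} = {X. X \<subseteq> {..<n} \<and> p X \<noteq> of_bool (G X)}"
    for p :: "nat set \<Rightarrow> 3"
    using assms(2) by auto
  then show ?thesis using assms(1) unfolding approximable_def by simp
qed

lemma approximable_not:
  assumes "approximable n t d b F"
  shows "approximable n t d b (\<lambda>X. \<not> F X)"
proof -
  obtain p :: "nat set \<Rightarrow> 3" where p: "p \<in> polys n d"
    "2 ^ t * card {X. X \<subseteq> {..<n} \<and> p X \<noteq> of_bool (F X)} \<le> b * 2 ^ n"
    using assms unfolding approximable_def by blast
  have "(\<lambda>X. 1 - p X) \<in> polys n d" by (intro polys_diff polys_const p)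
  moreover have "{X. X \<subseteq> {..<n} \<and> 1 - p X \<noteq> of_bool (\<not> F X)} = {X. X \<subseteq> {..<n} \<and> p X \<noteq> of_bool (F X)}"
    by (auto simp: of_bool_def)
  ultimately show ?thesis
    unfolding approximable_def using p(2) by (intro bexI[of _ "\<lambda>X. 1 - p X"]) (simp only:)
qed

lemma approximable_conj:
  assumes "approximable n t d b F" "approximable n t d' b' G"
  shows "approximable n t (d + d') (b + b') (\<lambda>X. F X \<and> G X)"
proof -
  obtain p :: "nat set \<Rightarrow> 3" where p: "p \<in> polys n d"
    "2 ^ t * card {X. X \<subseteq> {..<n} \<and> p X \<noteq> of_bool (F X)} \<le> b * 2 ^ n"
    using assms(1) unfolding approximable_def by blast
  obtain q :: "nat set \<Rightarrow> 3" where q: "q \<in> polys n d'"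
    "2 ^ t * card {X. X \<subseteq> {..<n} \<and> q X \<noteq> of_bool (G X)} \<le> b' * 2 ^ n"
    using assms(2) unfolding approximable_def by blast
  let ?P = "{X. X \<subseteq> {..<n} \<and> p X \<noteq> of_bool (F X)}"
  let ?Q = "{X. X \<subseteq> {..<n} \<and> q X \<noteq> of_bool (G X)}"
  let ?R = "{X. X \<subseteq> {..<n} \<and> p X * q X \<noteq> of_bool (F X \<and> G X)}"
  have "card ?R \<le> card (?P \<union> ?Q)"
    by (intro card_mono) (auto simp: of_bool_conj)
  also have "\<dots> \<le> card ?P + card ?Q" by (rule card_Un_le)
  finally have "2 ^ t * card ?R \<le> 2 ^ t * (card ?P + card ?Q)" by simp
  with p(2) q(2) have "2 ^ t * card ?R \<le> (b + b') * 2 ^ n"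
    by (simp only: distrib_left distrib_right)
  with polys_mult[OF p(1) q(1)] show ?thesis
    unfolding approximable_def by (intro bexI[of _ "\<lambda>X. p X * q X"])
qed

text \<open>A union bound: the \<open>n\<close> instances contribute \<open>n * b\<close> units of
  error, and the OR polynomial built from their approximations adds one more. Its degree depends on
  \<open>t\<close> but not on the number of disjuncts.\<close>

lemma approximable_ex:
  assumes "\<And>a. a < n \<Longrightarrow> approximable n t d b (F a)"
  shows "approximable n t (2 * t * d) (n * b + 1) (\<lambda>X. \<exists>a<n. F a X)"
proof -
  have "\<forall>a\<in>{..<n}. \<exists>p. (p :: nat set \<Rightarrow> 3) \<in> polys n d \<and>
      2 ^ t * card {X. X \<subseteq> {..<n} \<and> p X \<noteq> of_bool (F a X)} \<le> b * 2 ^ n"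
    using assms unfolding approximable_def by blast
  from bchoice[OF this] obtain p :: "nat \<Rightarrow> nat set \<Rightarrow> 3" where
    p: "\<And>a. a < n \<Longrightarrow> p a \<in> polys n d"
       "\<And>a. a < n \<Longrightarrow> 2 ^ t * card {X. X \<subseteq> {..<n} \<and> p a X \<noteq> of_bool (F a X)} \<le> b * 2 ^ n"
    by auto
  have "\<And>a. a \<in> {..<n} \<Longrightarrow> p a \<in> polys n d" using p(1) by (simp only: lessThan_iff)
  from greedy_or_polynomial[where t = t, OF finite_lessThan this] obtain u :: "nat set \<Rightarrow> 3" where
    u: "u \<in> polys n (2 * t * d)"
      "(\<forall>X. (\<forall>a\<in>{..<n}. p a X = 0) \<longrightarrow> u X = 1) \<and>
       2 ^ t * card {X. X \<subseteq> {..<n} \<and> (\<exists>a\<in>{..<n}. p a X \<noteq> 0) \<and> u X \<noteq> 0} \<le> 2 ^ n" by (rule bexE)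
  note u = u(1) u(2)[THEN conjunct1, rule_format] u(2)[THEN conjunct2]
  let ?E = "\<lambda>a. {X. X \<subseteq> {..<n} \<and> p a X \<noteq> of_bool (F a X)}"
  let ?U = "{X. X \<subseteq> {..<n} \<and> (\<exists>a\<in>{..<n}. p a X \<noteq> 0) \<and> u X \<noteq> 0}"
  let ?R = "{X. X \<subseteq> {..<n} \<and> 1 - u X \<noteq> of_bool (\<exists>a<n. F a X)}"
  \<comment> \<open>Off the sets \<open>?E a\<close> the values \<open>p a X\<close> are the true
    truth values, so only an error of \<open>u\<close> itself can remain.\<close>
  have "?R \<subseteq> ?U \<union> (\<Union>a<n. ?E a)"
  proof
    fix X assume X: "X \<in> ?R"
    show "X \<in> ?U \<union> (\<Union>a<n. ?E a)"
    proof (rule ccontr)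
      assume nin: "X \<notin> ?U \<union> (\<Union>a<n. ?E a)"
      then have pa: "p a X = of_bool (F a X)" if "a < n" for a
        using X that by auto
      show False
      proof (cases "\<exists>a<n. F a X")
        case True
        then have "\<exists>a\<in>{..<n}. p a X \<noteq> 0" using pa by auto
        with nin X have "u X = 0" by auto
        with X True show False by simp
      next
        case False
        then have "u X = 1" using pa by (intro u(2)) auto
        with X False show False by simp
      qed
    qed
  qed
  then have "card ?R \<le> card (?U \<union> (\<Union>a<n. ?E a))"
    by (intro card_mono) auto
  also have "\<dots> \<le> card ?U + card (\<Union>a<n. ?E a)" by (rule card_Un_le)
  also have "\<dots> \<le> card ?U + (\<Sum>a<n. card (?E a))"
    by (intro add_left_mono card_UN_le) simp
  finally have "2 ^ t * card ?R \<le> 2 ^ t * card ?U + (\<Sum>a<n. 2 ^ t * card (?E a))"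
    by (simp flip: distrib_left sum_distrib_left)
  also have "\<dots> \<le> 2 ^ n + (\<Sum>a<n. b * 2 ^ n)"
    by (intro add_mono u(3) sum_mono p(2)) auto
  also have "\<dots> = (n * b + 1) * 2 ^ n" by (simp add: algebra_simps)
  finally have "2 ^ t * card ?R \<le> (n * b + 1) * 2 ^ n" .
  moreover have "(\<lambda>X. 1 - u X) \<in> polys n (2 * t * d)"
    by (intro polys_diff polys_const u(1))
  ultimately show ?thesis
    unfolding approximable_def by (intro bexI[of _ "\<lambda>X. 1 - u X"])
qed

subsection \<open>Semantics\<close>

lemma tuples_0 [simp]: "tuples U 0 = {[]}"
  by (auto simp: tuples_def)

lemma tuples_Suc: "tuples U (Suc m) = {b # zs | b zs. b \<in> U \<and> zs \<in> tuples U m}"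
  by (auto simp: tuples_def length_Suc_conv)

lemma take_in_tuples: "zs \<in> tuples U m \<Longrightarrow> j \<le> m \<Longrightarrow> take j zs \<in> tuples U j"
  by (auto simp: tuples_def dest: in_set_takeD)

lemma finite_tuples: "finite U \<Longrightarrow> finite (tuples U m)"
  using finite_lists_length_eq[of U m] by (simp add: tuples_def conj_commute)

lemma finite_fun_tuples: "finite (fun_tuples A as)"
proof -
  have fin: "finite (tuples (universe A) a \<rightarrow>\<^sub>E universe A)" for a
    by (intro finite_PiE finite_tuples) (auto simp: universe_def)
  have "fun_tuples A as \<subseteq> {fs. set fs \<subseteq> (\<Union>a\<in>set as. tuples (universe A) a \<rightarrow>\<^sub>E universe A)
      \<and> length fs = length as}"
    by (auto simp: fun_tuples_def list_all2_conv_all_nth in_set_conv_nth) (metis nth_mem)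
  then show ?thesis
    by (rule finite_subset) (intro finite_lists_length_eq finite_UN_I fin, simp)
qed

lemma eval_cong:
  "(\<And>v. v \<in> fv_tm t \<Longrightarrow> e v = e' v) \<Longrightarrow> eval A fs e t = eval A fs e' t"
proof (induction t)
  case (FApp i ts)
  then have "map (eval A fs e) ts = map (eval A fs e') ts" by (intro map_cong) auto
  then show ?case by (simp only: eval.simps)
qed auto

lemma sat_cong:
  "(\<And>v. v \<in> fv \<phi> \<Longrightarrow> e v = e' v) \<Longrightarrow> sat A fs e \<phi> = sat A fs e' \<phi>"
proof (induction \<phi> arbitrary: e e')
  case (Rel r ts)
  then have "map (eval A fs e) ts = map (eval A fs e') ts" by (intro map_cong eval_cong) auto
  then show ?case by (simp only: sat.simps)
next
  case (Eq s t)
  then have "eval A fs e s = eval A fs e' s" "eval A fs e t = eval A fs e' t"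
    by (auto intro!: eval_cong)
  then show ?case by simp
next
  case (Le s t)
  then have "eval A fs e s = eval A fs e' s" "eval A fs e t = eval A fs e' t"
    by (auto intro!: eval_cong)
  then show ?case by simp
next
  case (BIT s t)
  then have "eval A fs e s = eval A fs e' s" "eval A fs e t = eval A fs e' t"
    by (auto intro!: eval_cong)
  then show ?case by simp
next
  case (Neg \<phi>)
  have "sat A fs e \<phi> = sat A fs e' \<phi>" using Neg.prems by (intro Neg.IH) auto
  then show ?case by simp
next
  case (Conj \<phi> \<psi>)
  have "sat A fs e \<phi> = sat A fs e' \<phi>" "sat A fs e \<psi> = sat A fs e' \<psi>"
    using Conj.prems by (auto intro!: Conj.IH simp del: sat.simps)
  then show ?case by simp
next
  case (Disj \<phi> \<psi>)
  have "sat A fs e \<phi> = sat A fs e' \<phi>" "sat A fs e \<psi> = sat A fs e' \<psi>"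
    using Disj.prems by (auto intro!: Disj.IH simp del: sat.simps)
  then show ?case by simp
next
  case (Exists v \<phi>)
  have "sat A fs (e(v := a)) \<phi> = sat A fs (e'(v := a)) \<phi>" for a
    using Exists.prems by (intro Exists.IH) auto
  then show ?case by simp
next
  case (Forall v \<phi>)
  have "sat A fs (e(v := a)) \<phi> = sat A fs (e'(v := a)) \<phi>" for a
    using Forall.prems by (intro Forall.IH) auto
  then show ?case by simp
qed

text \<open>Quantifying over whole assignments rather than tuples of values also covers lists
  \<open>ys\<close> with repeated variables.\<close>

lemma sat_foldr_Forall:
  "sat A fs e (foldr Forall ys \<psi>) \<longleftrightarrow>
    (\<forall>e'. (\<forall>v. v \<notin> set ys \<longrightarrow> e' v = e v) \<and> (\<forall>v\<in>set ys. e' v \<in> universe A) \<longrightarrow> sat A fs e' \<psi>)"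
proof (induction ys arbitrary: e)
  case Nil
  have "(\<forall>v. e' v = e v) \<longleftrightarrow> e' = e" for e' by (auto simp: fun_eq_iff)
  then show ?case by simp
next
  case (Cons y ys)
  show ?case
  proof
    assume L: "sat A fs e (foldr Forall (y # ys) \<psi>)"
    show "\<forall>e'. (\<forall>v. v \<notin> set (y # ys) \<longrightarrow> e' v = e v) \<and> (\<forall>v\<in>set (y # ys). e' v \<in> universe A)
      \<longrightarrow> sat A fs e' \<psi>"
    proof (intro allI impI)
      fix e' assume e': "(\<forall>v. v \<notin> set (y # ys) \<longrightarrow> e' v = e v) \<and> (\<forall>v\<in>set (y # ys). e' v \<in> universe A)"
      then have "sat A fs (e(y := e' y)) (foldr Forall ys \<psi>)" using L by simp
      with e' show "sat A fs e' \<psi>" unfolding Cons.IH by auto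
    qed
  next
    assume R: "\<forall>e'. (\<forall>v. v \<notin> set (y # ys) \<longrightarrow> e' v = e v) \<and> (\<forall>v\<in>set (y # ys). e' v \<in> universe A)
      \<longrightarrow> sat A fs e' \<psi>"
    have "sat A fs (e(y := a)) (foldr Forall ys \<psi>)" if a: "a \<in> universe A" for a
      unfolding Cons.IH
    proof (intro allI impI)
      fix e' assume e': "(\<forall>v. v \<notin> set ys \<longrightarrow> e' v = (e(y := a)) v) \<and> (\<forall>v\<in>set ys. e' v \<in> universe A)"
      \<comment> \<open>If \<open>y\<close> is bound again in \<open>ys\<close>, its value comes
        from the inner quantifier; otherwise it is \<open>a\<close>.\<close>
      then have "e' y \<in> universe A" using a by (cases "y \<in> set ys") auto
      with e' R show "sat A fs e' \<psi>" by auto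
    qed
    then show "sat A fs e (foldr Forall (y # ys) \<psi>)" by simp
  qed
qed

lemma fv_foldr_Forall: "fv (foldr Forall ys \<psi>) = fv \<psi> - set ys"
  by (induction ys) auto

lemma wf_fm_foldr_Forall: "wf_fm \<sigma> as (foldr Forall ys \<psi>) = wf_fm \<sigma> as \<psi>"
  by (induction ys) auto

lemma fv_skolem_prefix: "fv (skolem_prefix m v \<psi>) = fv \<psi> - {v..v + 2 * m}"
proof (induction m arbitrary: v)
  case (Suc m)
  have "{v..v + 2 * Suc m} = {v, v + 1} \<union> {v + 2..v + 2 + 2 * m}" by auto
  then show ?case using Suc[of "v + 2"] by auto
qed auto

lemma wf_fm_skolem_prefix: "wf_fm \<sigma> as (skolem_prefix m v \<psi>) = wf_fm \<sigma> as \<psi>"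
  by (induction m arbitrary: v) auto

subsection \<open>Substituting Skolem functions\<close>

text \<open>Variable \<open>2 * i\<close> is the existential variable preceded by \<open>i\<close>
  universal ones. It becomes function variable \<open>i\<close>, of arity \<open>i\<close>, applied
  to the first \<open>i\<close> odd variables; hence the arity list
  \<open>[0..<Suc m]\<close>.\<close>

fun sk_tm :: "tm \<Rightarrow> tm" where
  "sk_tm (Var v) = (if even v then FApp (v div 2) (map (\<lambda>j. Var (2 * j + 1)) [0..<v div 2]) else Var v)"
| "sk_tm (Cst c) = Cst c"
| "sk_tm MinC = MinC"
| "sk_tm (FApp i ts) = FApp i (map sk_tm ts)"

fun sk_fm :: "fm \<Rightarrow> fm" where
  "sk_fm (Eq s t) = Eq (sk_tm s) (sk_tm t)"
| "sk_fm (Le s t) = Le (sk_tm s) (sk_tm t)"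
| "sk_fm (BIT s t) = BIT (sk_tm s) (sk_tm t)"
| "sk_fm (Rel r ts) = Rel r (map sk_tm ts)"
| "sk_fm (Neg \<phi>) = Neg (sk_fm \<phi>)"
| "sk_fm (Conj \<phi> \<psi>) = Conj (sk_fm \<phi>) (sk_fm \<psi>)"
| "sk_fm (Disj \<phi> \<psi>) = Disj (sk_fm \<phi>) (sk_fm \<psi>)"
| "sk_fm (Exists v \<phi>) = Exists v (sk_fm \<phi>)"
| "sk_fm (Forall v \<phi>) = Forall v (sk_fm \<phi>)"

lemma qfree_sk_fm: "qfree \<psi> \<Longrightarrow> qfree (sk_fm \<psi>)"
  by (induction \<psi>) auto

lemma even_le_div2: "v \<le> 2 * m \<Longrightarrow> v div 2 \<le> (m::nat)"
  by auto

text \<open>Over the empty list of function variables a well-formed term is not an application, so a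
  case split replaces induction on terms.\<close>

lemma wf_sk_tm: "wf_tm \<sigma> [] t \<Longrightarrow> fv_tm t \<subseteq> {..2 * m} \<Longrightarrow> wf_tm \<sigma> [0..<Suc m] (sk_tm t)"
  by (cases t) (auto simp: nth_append dest: even_le_div2)

lemma wf_sk_fm:
  "qfree \<psi> \<Longrightarrow> wf_fm \<sigma> [] \<psi> \<Longrightarrow> fv \<psi> \<subseteq> {..2 * m} \<Longrightarrow> wf_fm \<sigma> [0..<Suc m] (sk_fm \<psi>)"
proof (induction \<psi>)
  case (Rel r ts)
  then show ?case by (auto simp del: upt_Suc intro!: wf_sk_tm)
qed (auto simp del: upt_Suc intro!: wf_sk_tm)

lemma fv_sk_tm:
  "wf_tm \<sigma> [] t \<Longrightarrow> fv_tm t \<subseteq> {..2 * m} \<Longrightarrow> fv_tm (sk_tm t) \<subseteq> (\<lambda>j. Suc (2 * j)) ` {..<m}"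
proof (cases t)
  case (Var v)
  assume "fv_tm t \<subseteq> {..2 * m}"
  with Var show ?thesis
    by (auto elim!: oddE)
qed auto

lemma fv_sk_fm:
  "qfree \<psi> \<Longrightarrow> wf_fm \<sigma> [] \<psi> \<Longrightarrow> fv \<psi> \<subseteq> {..2 * m} \<Longrightarrow> fv (sk_fm \<psi>) \<subseteq> (\<lambda>j. Suc (2 * j)) ` {..<m}"
proof (induction \<psi>)
  case (Rel r ts)
  then have "fv_tm (sk_tm t) \<subseteq> (\<lambda>j. Suc (2 * j)) ` {..<m}" if "t \<in> set ts" for t
    using that by (intro fv_sk_tm[of \<sigma>]) auto
  then show ?case by simp blast
qed (simp_all add: fv_sk_tm[of \<sigma>])

lemma eval_sk_tm:
  assumes "wf_tm \<sigma> [] t" "fv_tm t \<subseteq> {..2 * m}" "length zs = m" "\<And>j. j < m \<Longrightarrow> e (Suc (2 * j)) = zs ! j"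
  shows "eval A fs e (sk_tm t) = eval A [] (skolem_env fs zs) t"
proof (cases t)
  case (Var v)
  show ?thesis
  proof (cases "even v")
    case True
    then obtain i where i: "v = 2 * i" by blast
    then have "i \<le> m" using assms Var by simp
    then have "map (\<lambda>j. e (Suc (2 * j))) [0..<i] = take i zs"
      using assms by (intro nth_equalityI) auto
    then show ?thesis using Var i by (simp add: skolem_env_def comp_def)
  next
    case False
    then obtain i where i: "v = 2 * i + 1" by (blast elim: oddE)
    then have "i < m" using assms Var by simp
    then show ?thesis using Var i assms(4)[of i] by (simp add: skolem_env_def)
  qed
qed (use assms in auto)

lemma sat_sk_fm:
  assumes "length zs = m" "\<And>j. j < m \<Longrightarrow> e (Suc (2 * j)) = zs ! j"
  shows "qfree \<psi> \<Longrightarrow> wf_fm \<sigma> [] \<psi> \<Longrightarrow> fv \<psi> \<subseteq> {..2 * m} \<Longrightarrow>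
    sat A fs e (sk_fm \<psi>) = sat A [] (skolem_env fs zs) \<psi>"
proof (induction \<psi>)
  case (Rel r ts)
  then have "map (eval A fs e \<circ> sk_tm) ts = map (eval A [] (skolem_env fs zs)) ts"
    using eval_sk_tm[of \<sigma> _ m zs e A fs] assms by (intro map_cong) (auto simp: UN_subset_iff)
  then show ?case by (simp only: sk_fm.simps sat.simps map_map)
qed (simp_all add: eval_sk_tm[of \<sigma> _ m zs e A fs] assms)

lemma sat_Forall_sk_fm:
  assumes "qfree \<psi>" "wf_fm \<sigma> [] \<psi>" "fv \<psi> \<subseteq> {..2 * m}"
  shows "sat A fs e (foldr Forall (map (\<lambda>j. Suc (2 * j)) [0..<m]) (sk_fm \<psi>)) \<longleftrightarrow>
    (\<forall>zs\<in>tuples (universe A) m. sat A [] (skolem_env fs zs) \<psi>)" (is "sat _ _ _ (foldr Forall ?ys _) = _")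
proof -
  have "(\<forall>e'. (\<forall>v. v \<notin> set ?ys \<longrightarrow> e' v = e v) \<and> (\<forall>v\<in>set ?ys. e' v \<in> universe A) \<longrightarrow> sat A fs e' (sk_fm \<psi>))
    \<longleftrightarrow> (\<forall>zs\<in>tuples (universe A) m. sat A [] (skolem_env fs zs) \<psi>)" (is "?L = ?R")
  proof
    assume L: ?L
    show ?R
    proof
      fix zs assume zs: "zs \<in> tuples (universe A) m"
      define e' where "e' v = (if v \<in> set ?ys then zs ! (v div 2) else e v)" for v
      have "zs ! j \<in> universe A" if "j < m" for j
        using zs that nth_mem[of j zs] by (auto simp: tuples_def)
      then have "(\<forall>v. v \<notin> set ?ys \<longrightarrow> e' v = e v) \<and> (\<forall>v\<in>set ?ys. e' v \<in> universe A)"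
        by (auto simp: e'_def)
      with L have "sat A fs e' (sk_fm \<psi>)" by blast
      moreover have "e' (Suc (2 * j)) = zs ! j" if "j < m" for j
        using that by (simp add: e'_def)
      ultimately show "sat A [] (skolem_env fs zs) \<psi>"
        using sat_sk_fm[of zs m e' \<psi> \<sigma> A fs] zs assms by (simp add: tuples_def)
    qed
  next
    assume R: ?R
    show ?L
    proof (intro allI impI)
      fix e' assume e': "(\<forall>v. v \<notin> set ?ys \<longrightarrow> e' v = e v) \<and> (\<forall>v\<in>set ?ys. e' v \<in> universe A)"
      let ?zs = "map (\<lambda>j. e' (Suc (2 * j))) [0..<m]"
      have "?zs \<in> tuples (universe A) m" using e' by (auto simp: tuples_def)
      with R show "sat A fs e' (sk_fm \<psi>)"
        using sat_sk_fm[of ?zs m e' \<psi> \<sigma> A fs] assms by simp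
    qed
  qed
  then show ?thesis unfolding sat_foldr_Forall .
qed

lemma sharp_Pi1_Sk_subset: "sharp_Pi1_Sk \<subseteq> sharp_Pi1"
proof
  fix f assume "f \<in> sharp_Pi1_Sk"
  then obtain \<sigma> m \<psi> where *: "vocabulary \<sigma>" "wf_fm \<sigma> [] (skolem_prefix m 0 \<psi>)"
    "fv (skolem_prefix m 0 \<psi>) = {}" "qfree \<psi>"
    "\<And>A. is_struct \<sigma> A \<Longrightarrow> f (enc \<sigma> A) = card {fs \<in> fun_tuples A [0..<Suc m].
                \<forall>zs\<in>tuples (universe A) m. sat A [] (skolem_env fs zs) \<psi>}"
    unfolding sharp_Pi1_Sk_def by blast
  have wf: "wf_fm \<sigma> [] \<psi>" using *(2) by (simp add: wf_fm_skolem_prefix)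
  have fv: "fv \<psi> \<subseteq> {..2 * m}" using *(3) by (auto simp: fv_skolem_prefix)
  let ?\<phi> = "foldr Forall (map (\<lambda>j. Suc (2 * j)) [0..<m]) (sk_fm \<psi>)"
  have "f (enc \<sigma> A) = card {(fs, cs). fs \<in> fun_tuples A [0..<Suc m] \<and> cs \<in> tuples (universe A) 0 \<and>
      sat A fs (\<lambda>j. cs ! j) ?\<phi>}" if A: "is_struct \<sigma> A" for A
  proof -
    let ?S = "{fs \<in> fun_tuples A [0..<Suc m].
                \<forall>zs\<in>tuples (universe A) m. sat A [] (skolem_env fs zs) \<psi>}"
    \<comment> \<open>There are no free individual variables, so each function tuple is merely
      paired with the empty list and the two counts coincide.\<close>
    have "{(fs, cs). fs \<in> fun_tuples A [0..<Suc m] \<and> cs \<in> tuples (universe A) 0 \<and>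
      sat A fs (\<lambda>j. cs ! j) ?\<phi>} = (\<lambda>fs. (fs, [] :: nat list)) ` ?S"
      unfolding sat_Forall_sk_fm[OF *(4) wf fv] by auto
    moreover have "card ((\<lambda>fs. (fs, [] :: nat list)) ` ?S) = card ?S"
      by (intro card_image inj_onI) simp
    ultimately show ?thesis using *(5)[OF A] by (simp only:)
  qed
  moreover have "wf_fm \<sigma> [0..<Suc m] ?\<phi>"
    unfolding wf_fm_foldr_Forall by (rule wf_sk_fm[OF *(4) wf fv])
  moreover have "fv ?\<phi> \<subseteq> {..<0}"
    using fv_sk_fm[OF *(4) wf fv] unfolding fv_foldr_Forall by auto
  moreover have "qfree (sk_fm \<psi>)" by (rule qfree_sk_fm[OF *(4)])
  ultimately show "f \<in> sharp_Pi1"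
    unfolding sharp_Pi1_def mem_Collect_eq
    by (intro exI[of _ \<sigma>] exI[of _ "[0..<Suc m]"] exI[of _ "0::nat"] exI[of _ ?\<phi>]
      exI[of _ "map (\<lambda>j. Suc (2 * j)) [0..<m]"] exI[of _ "sk_fm \<psi>"] conjI allI impI *(1) refl)
qed

subsection \<open>Skolem functions exist iff the sentence holds\<close>

text \<open>A version of \<open>skolem_env\<close> suited to induction over the prefix: the
  quantified variables start at an offset \<open>v\<close>, and the variables below it keep their
  values from \<open>e\<close>.\<close>

definition prefix_env :: "(nat \<Rightarrow> nat) \<Rightarrow> nat \<Rightarrow> (nat \<Rightarrow> nat list \<Rightarrow> nat) \<Rightarrow> nat list \<Rightarrow> nat \<Rightarrow> nat" where
  "prefix_env e v g zs w =
     (if w < v then e w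
      else if even (w - v) then g ((w - v) div 2) (take ((w - v) div 2) zs)
      else zs ! ((w - v) div 2))"

lemma prefix_env_Cons:
  assumes "g 0 [] = a" "\<And>j zs. g (Suc j) (b # zs) = g' j zs"
  shows "prefix_env (e(v := a, v + 1 := b)) (v + 2) g' zs = prefix_env e v g (b # zs)"
proof
  fix w
  consider "w < v" | "w = v" | "w = v + 1" | k where "w = v + 2 + k"
    by (metis Suc_eq_plus1 add_2_eq_Suc' less_Suc_eq_le linorder_not_less nat_less_le le_iff_add)
  then show "prefix_env (e(v := a, v + 1 := b)) (v + 2) g' zs w = prefix_env e v g (b # zs) w"
  proof cases
    case (4 k)
    have "w - v = 2 + k" "w - (v + 2) = k" "\<not> w < v" "\<not> w < v + 2" "(2 + k) div 2 = Suc (k div 2)"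
      using 4 by auto
    then show ?thesis using assms by (simp add: prefix_env_def)
  qed (auto simp: prefix_env_def assms)
qed

text \<open>Skolemization by induction on the number of universal quantifiers: for each value
  \<open>b\<close> of the outermost one the remaining prefix has its own Skolem functions, and
  choice merges these into functions with \<open>b\<close> as an additional first argument.\<close>

lemma sat_skolem_prefix_iff:
  assumes "fv \<psi> \<subseteq> {..v + 2 * m}"
  shows "sat A fs e (skolem_prefix m v \<psi>) \<longleftrightarrow>
    (\<exists>g. (\<forall>j\<le>m. \<forall>zs\<in>tuples (universe A) j. g j zs \<in> universe A) \<and>
         (\<forall>zs\<in>tuples (universe A) m. sat A fs (prefix_env e v g zs) \<psi>))"
  using assms
proof (induction m arbitrary: v e)
  case 0
  have eq: "sat A fs (prefix_env e v g []) \<psi> = sat A fs (e(v := g 0 [])) \<psi>" for g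
    using 0 by (intro sat_cong) (auto simp: prefix_env_def)
  show ?case
  proof
    assume "sat A fs e (skolem_prefix 0 v \<psi>)"
    then obtain a where "a \<in> universe A" "sat A fs (e(v := a)) \<psi>" by auto
    then show "\<exists>g. (\<forall>j\<le>0. \<forall>zs\<in>tuples (universe A) j. g j zs \<in> universe A) \<and>
         (\<forall>zs\<in>tuples (universe A) 0. sat A fs (prefix_env e v g zs) \<psi>)"
      by (intro exI[of _ "\<lambda>_ _. a"]) (simp add: eq)
  qed (auto simp: eq)
next
  case (Suc m)
  let ?U = "universe A"
  have IH: "sat A fs e' (skolem_prefix m (v + 2) \<psi>) \<longleftrightarrow>
    (\<exists>g. (\<forall>j\<le>m. \<forall>zs\<in>tuples ?U j. g j zs \<in> ?U) \<and>
         (\<forall>zs\<in>tuples ?U m. sat A fs (prefix_env e' (v + 2) g zs) \<psi>))" for e'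
    using Suc.prems by (intro Suc.IH) auto
  show ?case
  proof
    assume "sat A fs e (skolem_prefix (Suc m) v \<psi>)"
    then obtain a where a: "a \<in> ?U" and
      "\<forall>b\<in>?U. \<exists>g. (\<forall>j\<le>m. \<forall>zs\<in>tuples ?U j. g j zs \<in> ?U) \<and>
         (\<forall>zs\<in>tuples ?U m. sat A fs (prefix_env (e(v := a, v + 1 := b)) (v + 2) g zs) \<psi>)"
      using IH by auto
    from bchoice[OF this(2)] obtain G where
      G: "\<And>b j zs. b \<in> ?U \<Longrightarrow> j \<le> m \<Longrightarrow> zs \<in> tuples ?U j \<Longrightarrow> G b j zs \<in> ?U"
        "\<And>b zs. b \<in> ?U \<Longrightarrow> zs \<in> tuples ?U m \<Longrightarrow>
           sat A fs (prefix_env (e(v := a, v + 1 := b)) (v + 2) (G b) zs) \<psi>"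
      by blast
    \<comment> \<open>The first Skolem function is the constant \<open>a\<close>; a later one reads
      \<open>b\<close> off the head of its argument list and passes the tail to the functions chosen
      for \<open>b\<close>.\<close>
    define g where "g j zs = (case j of 0 \<Rightarrow> a | Suc j' \<Rightarrow> G (hd zs) j' (tl zs))" for j zs
    have "g j zs \<in> ?U" if "j \<le> Suc m" "zs \<in> tuples ?U j" for j zs
      using that a G(1) by (cases j) (auto simp: g_def tuples_Suc)
    moreover have "sat A fs (prefix_env e v g zs) \<psi>" if zs: "zs \<in> tuples ?U (Suc m)" for zs
    proof -
      obtain b zs' where b: "b \<in> ?U" "zs' \<in> tuples ?U m" "zs = b # zs'"
        using zs by (auto simp: tuples_Suc)
      have "prefix_env (e(v := a, v + 1 := b)) (v + 2) (G b) zs' = prefix_env e v g (b # zs')"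
        by (rule prefix_env_Cons) (auto simp: g_def)
      then show ?thesis using G(2)[OF b(1,2)] b(3) by simp
    qed
    ultimately show "\<exists>g. (\<forall>j\<le>Suc m. \<forall>zs\<in>tuples ?U j. g j zs \<in> ?U) \<and>
         (\<forall>zs\<in>tuples ?U (Suc m). sat A fs (prefix_env e v g zs) \<psi>)"
      by (intro exI[of _ g]) simp
  next
    assume "\<exists>g. (\<forall>j\<le>Suc m. \<forall>zs\<in>tuples ?U j. g j zs \<in> ?U) \<and>
         (\<forall>zs\<in>tuples ?U (Suc m). sat A fs (prefix_env e v g zs) \<psi>)"
    then obtain g where g: "\<And>j zs. j \<le> Suc m \<Longrightarrow> zs \<in> tuples ?U j \<Longrightarrow> g j zs \<in> ?U"
      "\<And>zs. zs \<in> tuples ?U (Suc m) \<Longrightarrow> sat A fs (prefix_env e v g zs) \<psi>" by blast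
    have "sat A fs (e(v := g 0 [], v + 1 := b)) (skolem_prefix m (v + 2) \<psi>)" if b: "b \<in> ?U" for b
      unfolding IH
    proof (intro exI[of _ "\<lambda>j zs. g (Suc j) (b # zs)"] conjI allI impI ballI)
      fix j zs assume "j \<le> m" "zs \<in> tuples ?U j"
      with b show "g (Suc j) (b # zs) \<in> ?U" by (intro g) (auto simp: tuples_Suc)
    next
      fix zs assume "zs \<in> tuples ?U m"
      then have "sat A fs (prefix_env e v g (b # zs)) \<psi>"
        using b by (intro g) (auto simp: tuples_Suc)
      moreover have "prefix_env (e(v := g 0 [], v + 1 := b)) (v + 2) (\<lambda>j zs. g (Suc j) (b # zs)) zs
          = prefix_env e v g (b # zs)"
        by (rule prefix_env_Cons) auto
      ultimately show "sat A fs (prefix_env (e(v := g 0 [], v + 1 := b)) (v + 2)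
        (\<lambda>j zs. g (Suc j) (b # zs)) zs) \<psi>" by simp
    qed
    moreover have "g 0 [] \<in> ?U" by (rule g) auto
    ultimately show "sat A fs e (skolem_prefix (Suc m) v \<psi>)" by auto
  qed
qed

text \<open>Positivity of the count is a first-order property of the structure. The set counted is
  finite, so a positive cardinality means that Skolem functions exist.\<close>

lemma skolem_functions_exist_iff:
  assumes "fv \<psi> \<subseteq> {..2 * m}"
  shows "0 < card {fs \<in> fun_tuples A [0..<Suc m].
      \<forall>zs\<in>tuples (universe A) m. sat A [] (skolem_env fs zs) \<psi>}
    \<longleftrightarrow> sat A [] e (skolem_prefix m 0 \<psi>)"
proof -
  let ?U = "universe A"
  have env: "sat A [] (skolem_env fs zs) \<psi> = sat A [] (prefix_env e 0 g zs) \<psi>"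
    if "zs \<in> tuples ?U m" "\<And>j ys. j \<le> m \<Longrightarrow> ys \<in> tuples ?U j \<Longrightarrow> (fs ! j) ys = g j ys" for fs g zs
  proof (rule sat_cong)
    fix w assume "w \<in> fv \<psi>"
    then have "w div 2 \<le> m" using assms by auto
    then have "(fs ! (w div 2)) (take (w div 2) zs) = g (w div 2) (take (w div 2) zs)"
      using take_in_tuples[OF that(1)] that(2) by blast
    then show "skolem_env fs zs w = prefix_env e 0 g zs w"
      by (simp add: skolem_env_def prefix_env_def)
  qed
  have "0 < card {fs \<in> fun_tuples A [0..<Suc m]. \<forall>zs\<in>tuples ?U m. sat A [] (skolem_env fs zs) \<psi>}
    \<longleftrightarrow> (\<exists>fs\<in>fun_tuples A [0..<Suc m]. \<forall>zs\<in>tuples ?U m. sat A [] (skolem_env fs zs) \<psi>)"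
    using finite_fun_tuples[of A "[0..<Suc m]"] by (subst card_gt_0_iff) auto
  also have "\<dots> \<longleftrightarrow> (\<exists>g. (\<forall>j\<le>m. \<forall>zs\<in>tuples ?U j. g j zs \<in> ?U) \<and>
         (\<forall>zs\<in>tuples ?U m. sat A [] (prefix_env e 0 g zs) \<psi>))"
  proof
    assume "\<exists>fs\<in>fun_tuples A [0..<Suc m]. \<forall>zs\<in>tuples ?U m. sat A [] (skolem_env fs zs) \<psi>"
    then obtain fs where fs: "fs \<in> fun_tuples A [0..<Suc m]"
      "\<And>zs. zs \<in> tuples ?U m \<Longrightarrow> sat A [] (skolem_env fs zs) \<psi>" by blast
    have "fs ! j \<in> tuples ?U j \<rightarrow>\<^sub>E ?U" if "j \<le> m" for j
    proof -
      have "length fs = Suc m" "\<forall>i<length fs. fs ! i \<in> tuples ?U ([0..<Suc m] ! i) \<rightarrow>\<^sub>E ?U"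
        using fs(1) by (auto simp add: fun_tuples_def list_all2_conv_all_nth simp del: upt_Suc nth_upt)
      then have "fs ! j \<in> tuples ?U ([0..<Suc m] ! j) \<rightarrow>\<^sub>E ?U" using that by auto
      with that show ?thesis by (simp add: less_Suc_eq_le del: upt_Suc)
    qed
    then show "\<exists>g. (\<forall>j\<le>m. \<forall>zs\<in>tuples ?U j. g j zs \<in> ?U) \<and>
         (\<forall>zs\<in>tuples ?U m. sat A [] (prefix_env e 0 g zs) \<psi>)"
      using fs(2) env[of _ fs "\<lambda>j. fs ! j"] by (intro exI[of _ "\<lambda>j. fs ! j"]) auto
  next
    assume "\<exists>g. (\<forall>j\<le>m. \<forall>zs\<in>tuples ?U j. g j zs \<in> ?U) \<and>
         (\<forall>zs\<in>tuples ?U m. sat A [] (prefix_env e 0 g zs) \<psi>)"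
    then obtain g where g: "\<And>j zs. j \<le> m \<Longrightarrow> zs \<in> tuples ?U j \<Longrightarrow> g j zs \<in> ?U"
      "\<And>zs. zs \<in> tuples ?U m \<Longrightarrow> sat A [] (prefix_env e 0 g zs) \<psi>" by blast
    \<comment> \<open>Restriction makes the functions extensional, as \<open>fun_tuples\<close>
      demands, without changing their values on tuples over the universe.\<close>
    let ?fs = "map (\<lambda>j. restrict (g j) (tuples ?U j)) [0..<Suc m]"
    have "?fs \<in> fun_tuples A [0..<Suc m]"
      using g(1) by (auto simp: fun_tuples_def list_all2_conv_all_nth less_Suc_eq_le simp del: upt_Suc)
    moreover have "sat A [] (skolem_env ?fs zs) \<psi>" if "zs \<in> tuples ?U m" for zs
      using g(2)[OF that] env[OF that, of ?fs g] by (simp add: less_Suc_eq_le del: upt_Suc)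
    ultimately show "\<exists>fs\<in>fun_tuples A [0..<Suc m]. \<forall>zs\<in>tuples ?U m. sat A [] (skolem_env fs zs) \<psi>"
      by blast
  qed
  also have "\<dots> \<longleftrightarrow> sat A [] e (skolem_prefix m 0 \<psi>)"
    using assms by (intro sat_skolem_prefix_iff[symmetric]) simp
  finally show ?thesis .
qed

subsection \<open>Parity is not first-order\<close>

text \<open>The first relation is \<open>X\<close>, padded with zeros to its arity; all else is trivial.\<close>

definition set_struct :: "vocab \<Rightarrow> nat \<Rightarrow> nat set \<Rightarrow> struct" where
  "set_struct \<sigma> n X = \<lparr>usize = n,
     rels = (\<lambda>x. x # replicate (hd (rel_arities \<sigma>) - 1) 0) ` X # replicate (length (tl (rel_arities \<sigma>))) {},
     csts = replicate (num_csts \<sigma>) 0\<rparr>"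

lemma is_struct_set_struct:
  assumes "vocabulary \<sigma>" "rel_arities \<sigma> \<noteq> []" "1 \<le> n" "X \<subseteq> {..<n}"
  shows "is_struct \<sigma> (set_struct \<sigma> n X)"
proof -
  obtain a as where \<sigma>: "rel_arities \<sigma> = a # as" using assms(2) by (cases "rel_arities \<sigma>") auto
  then have "1 \<le> a" using assms(1) by (simp add: vocabulary_def)
  then have "(\<lambda>x. x # replicate (a - 1) 0) ` X \<subseteq> tuples {..<n} a"
    using assms(3,4) by (auto simp: tuples_def)
  moreover have "list_all2 (\<lambda>R a. R \<subseteq> tuples {..<n} a) (replicate (length as) {}) as"
    by (simp add: list_all2_conv_all_nth)
  moreover have "replicate (num_csts \<sigma>) 0 \<in> tuples {..<n} (num_csts \<sigma>)"
    using assms(3) by (auto simp: tuples_def)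
  ultimately show ?thesis
    using assms(3) \<sigma> by (simp add: is_struct_def set_struct_def universe_def)
qed

text \<open>Terms without function variables do not see \<open>X\<close>. Atoms built from equality,
  order and \<open>BIT\<close> are therefore constant in \<open>X\<close>, however complicated these
  predicates are on numbers.\<close>

lemma eval_set_struct:
  "wf_tm \<sigma> [] t \<Longrightarrow> eval (set_struct \<sigma> n X) fs e t = eval (set_struct \<sigma> n {}) fs e t"
  by (cases t) (auto simp: set_struct_def)

lemma approximable_mem: "approximable n t 1 b (\<lambda>X. x \<in> X)"
proof (cases "x < n")
  case True
  have "(\<lambda>X. of_bool ({x} \<subseteq> X) :: 3) \<in> polys n 1"
    using True by (intro polys_monomial) auto
  then show ?thesis by (intro approximable_exact) simp
next
  case False
  have "approximable n t 1 b (\<lambda>X. False)"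
    by (intro approximable_exact polys_const)
  then show ?thesis by (rule approximable_cong) (use False in auto)
qed

text \<open>The argument tuple is independent of \<open>X\<close>. If it carries the zero padding,
  an atom of the first relation is membership of a fixed element; every other relational atom is
  constantly false.\<close>

lemma approximable_atom:
  assumes "rel_arities \<sigma> \<noteq> []" "r < length (rel_arities \<sigma>)" "\<And>s. s \<in> set ts \<Longrightarrow> wf_tm \<sigma> [] s"
  shows "approximable n t 1 b (\<lambda>X. sat (set_struct \<sigma> n X) fs e (Rel r ts))"
proof -
  let ?k = "hd (rel_arities \<sigma>) - 1"
  define l where "l = map (eval (set_struct \<sigma> n {}) fs e) ts"
  have l: "map (eval (set_struct \<sigma> n X) fs e) ts = l" for X
    unfolding l_def using assms(3) eval_set_struct by (intro map_cong refl) blast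
  have const: "approximable n t 1 b (\<lambda>X. False)"
    by (intro approximable_exact polys_const)
  consider "r = 0" "\<exists>x. l = x # replicate ?k 0" | "r = 0" "\<nexists>x. l = x # replicate ?k 0" | "r \<noteq> 0" by blast
  then show ?thesis
  proof cases
    case 1
    then obtain x where x: "l = x # replicate ?k 0" by blast
    have "sat (set_struct \<sigma> n X) fs e (Rel r ts) \<longleftrightarrow> x \<in> X" for X
      unfolding sat.simps l using 1(1) x by (auto simp: set_struct_def)
    then show ?thesis by (simp only: approximable_mem)
  next
    case 2
    then have "\<not> sat (set_struct \<sigma> n X) fs e (Rel r ts)" for X
      unfolding sat.simps l by (auto simp: set_struct_def)
    then show ?thesis using const by (simp only: simp_thms)
  next
    case 3
    then have "\<not> sat (set_struct \<sigma> n X) fs e (Rel r ts)" for X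
      unfolding sat.simps l using assms(2) by (cases r) (auto simp: set_struct_def)
    then show ?thesis using const by (simp only: simp_thms)
  qed
qed

text \<open>These inequalities show that one connective or quantifier raises the exponent in the
  bounds \<open>(2 * t) ^ k\<close> and \<open>(n + 1) ^ k\<close> by at most one.\<close>

lemma power_step_bounds:
  fixes k t n :: nat
  assumes "1 \<le> t" "1 \<le> n"
  shows "1 \<le> (2 * t) ^ k" "(2 * t) ^ k + (2 * t) ^ k \<le> (2 * t) ^ Suc k"
    "(n + 1) ^ k + (n + 1) ^ k \<le> (n + 1) ^ Suc k" "n * (n + 1) ^ k + 1 \<le> (n + 1) ^ Suc k"
proof -
  show "1 \<le> (2 * t) ^ k" using assms by simp
  have "2 * (2 * t) ^ k \<le> (2 * t) * (2 * t) ^ k" using assms by (intro mult_right_mono) auto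
  then show "(2 * t) ^ k + (2 * t) ^ k \<le> (2 * t) ^ Suc k"
    by (simp only: power_Suc mult_2[of "(2 * t) ^ k"])
  have "2 * (n + 1) ^ k \<le> (n + 1) * (n + 1) ^ k" using assms by (intro mult_right_mono) auto
  then show "(n + 1) ^ k + (n + 1) ^ k \<le> (n + 1) ^ Suc k" by simp
  show "n * (n + 1) ^ k + 1 \<le> (n + 1) ^ Suc k" by simp
qed

text \<open>The exponent is uniform in \<open>n\<close>, \<open>t\<close> and \<open>e\<close>;
  uniformity in \<open>e\<close> is what the quantifier cases rely on. Disjunction and universal
  quantification reduce to the other cases by negation.\<close>

lemma fo_approximable:
  assumes "rel_arities \<sigma> \<noteq> []" "wf_fm \<sigma> [] \<phi>"
  shows "\<exists>k. \<forall>n\<ge>1. \<forall>t\<ge>1. \<forall>e. approximable n t ((2 * t) ^ k) ((n + 1) ^ k)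
    (\<lambda>X. sat (set_struct \<sigma> n X) fs e \<phi>)"
proof -
  let ?A = "\<lambda>k n t F. approximable n t ((2 * t) ^ k) ((n + 1) ^ k) F"
  have const: "?A 0 n t (\<lambda>X. c)" for n t c
    by (intro approximable_exact polys_const)
  have inv: "\<exists>k. \<forall>n\<ge>1. \<forall>t\<ge>1. \<forall>e. ?A k n t (F n e)" if F: "\<And>n e X. F n e X = F n e {}"
    for F :: "nat \<Rightarrow> (nat \<Rightarrow> nat) \<Rightarrow> nat set \<Rightarrow> bool"
  proof (intro exI[of _ 0] allI impI)
    show "?A 0 n t (F n e)" for n t e
      by (rule approximable_cong[OF const[of n t "F n e {}"]]) (rule F)
  qed
  \<comment> \<open>Brings two subformulas with different exponents to a common one.\<close>
  have lift: "?A k' n t F" if "?A k n t F" "k \<le> k'" "1 \<le> t" for k k' n t F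
    using that by (intro approximable_mono[OF that(1)] power_increasing) auto
  have conj: "\<exists>k. \<forall>n\<ge>1. \<forall>t\<ge>1. \<forall>e. ?A k n t (\<lambda>X. F n e X \<and> G n e X)"
    if F: "\<exists>k. \<forall>n\<ge>1. \<forall>t\<ge>1. \<forall>e. ?A k n t (F n e)" and G: "\<exists>k. \<forall>n\<ge>1. \<forall>t\<ge>1. \<forall>e. ?A k n t (G n e)"
    for F G :: "nat \<Rightarrow> (nat \<Rightarrow> nat) \<Rightarrow> nat set \<Rightarrow> bool"
  proof -
    obtain k where k: "\<And>n t e. 1 \<le> n \<Longrightarrow> 1 \<le> t \<Longrightarrow> ?A k n t (F n e)" using F by blast
    obtain k' where k': "\<And>n t e. 1 \<le> n \<Longrightarrow> 1 \<le> t \<Longrightarrow> ?A k' n t (G n e)" using G by blast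
    have "?A (Suc (max k k')) n t (\<lambda>X. F n e X \<and> G n e X)" if "1 \<le> n" "1 \<le> t" for n t e
      using power_step_bounds[OF that(2,1), of "max k k'"]
      by (intro approximable_mono[OF approximable_conj[OF
            lift[OF k[OF that] max.cobounded1[of k k'] that(2)] lift[OF k'[OF that] max.cobounded2[of k' k] that(2)]]])
    then show ?thesis by blast
  qed
  have neg: "\<exists>k. \<forall>n\<ge>1. \<forall>t\<ge>1. \<forall>e. ?A k n t (\<lambda>X. \<not> F n e X)"
    if "\<exists>k. \<forall>n\<ge>1. \<forall>t\<ge>1. \<forall>e. ?A k n t (F n e)"
    for F :: "nat \<Rightarrow> (nat \<Rightarrow> nat) \<Rightarrow> nat set \<Rightarrow> bool"
    using that approximable_not by blast
  have ex: "\<exists>k. \<forall>n\<ge>1. \<forall>t\<ge>1. \<forall>e. ?A k n t (\<lambda>X. \<exists>a<n. F n (e(v := a)) X)"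
    if F: "\<exists>k. \<forall>n\<ge>1. \<forall>t\<ge>1. \<forall>e. ?A k n t (F n e)"
    for F :: "nat \<Rightarrow> (nat \<Rightarrow> nat) \<Rightarrow> nat set \<Rightarrow> bool" and v
  proof -
    obtain k where k: "\<And>n t e. 1 \<le> n \<Longrightarrow> 1 \<le> t \<Longrightarrow> ?A k n t (F n e)" using F by blast
    have "?A (Suc k) n t (\<lambda>X. \<exists>a<n. F n (e(v := a)) X)" if "1 \<le> n" "1 \<le> t" for n t e
      using power_step_bounds(4)[OF that(2,1), of k]
      by (intro approximable_mono[OF approximable_ex[OF k[OF that]]]) auto
    then show ?thesis by blast
  qed
  show ?thesis
    using assms(2)
  proof (induction \<phi>)
    case (Rel r ts)
    have "approximable n t ((2 * t) ^ 0) ((n + 1) ^ 0) (\<lambda>X. sat (set_struct \<sigma> n X) fs e (Rel r ts))" for n t e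
      using approximable_atom[OF assms(1), of r ts n t 1 fs e] Rel by simp
    then show ?case by blast
  next
    case (Eq s u)
    have "sat (set_struct \<sigma> n X) fs e (Eq s u) = sat (set_struct \<sigma> n {}) fs e (Eq s u)" for n X e
      using Eq by (simp add: eval_set_struct[of \<sigma> _ n X])
    then show ?case by (rule inv)
  next
    case (Le s u)
    have "sat (set_struct \<sigma> n X) fs e (Le s u) = sat (set_struct \<sigma> n {}) fs e (Le s u)" for n X e
      using Le by (simp add: eval_set_struct[of \<sigma> _ n X])
    then show ?case by (rule inv)
  next
    case (BIT s u)
    have "sat (set_struct \<sigma> n X) fs e (BIT s u) = sat (set_struct \<sigma> n {}) fs e (BIT s u)" for n X e
      using BIT by (simp add: eval_set_struct[of \<sigma> _ n X])
    then show ?case by (rule inv)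
  next
    case (Neg \<phi>)
    then show ?case using neg[of "\<lambda>n e X. sat (set_struct \<sigma> n X) fs e \<phi>"] by simp
  next
    case (Conj \<phi> \<psi>)
    then show ?case using conj[of "\<lambda>n e X. sat (set_struct \<sigma> n X) fs e \<phi>"
      "\<lambda>n e X. sat (set_struct \<sigma> n X) fs e \<psi>"] by simp
  next
    case (Disj \<phi> \<psi>)
    then show ?case using neg[OF conj[OF neg[of "\<lambda>n e X. sat (set_struct \<sigma> n X) fs e \<phi>"]
      neg[of "\<lambda>n e X. sat (set_struct \<sigma> n X) fs e \<psi>"]]] by simp
  next
    case (Exists v \<phi>)
    then show ?case using ex[of "\<lambda>n e X. sat (set_struct \<sigma> n X) fs e \<phi>" v]
      by (simp add: universe_def set_struct_def Bex_def)
  next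
    case (Forall v \<phi>)
    then show ?case using neg[OF ex[OF neg[of "\<lambda>n e X. sat (set_struct \<sigma> n X) fs e \<phi>"], of v]]
      by (simp add: universe_def set_struct_def Ball_def)
  qed
qed

text \<open>For universe size 2 * 2 ^ s and t = (s + 2) k + 2, the degree (2 t) ^ k is
  polylogarithmic in the size, so for a suitable \<open>s\<close> it falls below the square-root
  bound of \<open>even_card_not_approximable\<close>.\<close>

lemma polylog_growth:
  "\<exists>s. 16 * ((2 * ((s + 2) * k + 2)) ^ k + 1)\<^sup>2 < 2 * 2 ^ s + (1::nat)"
proof -
  \<comment> \<open>Taking \<open>s + 2\<close> to be the power 2 ^ r makes \<open>x\<close> at most
    \<open>B * 2 ^ r\<close>, so comparing with 2 ^ s becomes the comparison of exponents D + 4 k q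
    \<le> s. The evenness of \<open>r = 2 * q\<close> gives 2 ^ r \<ge> (q + 1)^2, which suffices
    since q \<ge> D + 4 k + 2.\<close>
  define B where "B = 2 * (k + 2)"
  define D where "D = 64 * B ^ (2 * k)"
  define q where "q = D + 4 * k + 2"
  define r where "r = 2 * q"
  define s where "s = (2::nat) ^ r - 2"
  define x where "x = 2 * ((s + 2) * k + 2)"
  have "q + 1 \<le> 2 ^ q" using less_exp[of q] by (simp add: Suc_le_eq)
  then have "(q + 1)\<^sup>2 \<le> (2 ^ q)\<^sup>2" by (rule power_mono) simp
  then have r1: "q * q + 2 * q + 1 \<le> 2 ^ r"
    by (simp add: r_def power_mult power2_eq_square power_mult_distrib flip: power_mult_distrib)
  have "D + 4 * k * q + 2 \<le> q * q + 2 * q"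
    by (simp add: q_def algebra_simps)
  with r1 have s1: "D + 4 * k * q \<le> s" and s2: "s + 2 = 2 ^ r"
    by (auto simp: s_def)
  have "x \<le> B * 2 ^ r"
    unfolding x_def s2 B_def by (simp add: algebra_simps)
  then have "x ^ (2 * k) \<le> (B * 2 ^ r) ^ (2 * k)" by (rule power_mono) simp
  also have "\<dots> = B ^ (2 * k) * 2 ^ (4 * k * q)"
    by (simp add: power_mult_distrib r_def mult_ac flip: power_mult)
  finally have x: "64 * x ^ (2 * k) \<le> D * 2 ^ (4 * k * q)" by (simp add: D_def)
  have "1 \<le> x ^ k" by (simp add: x_def)
  then have "x ^ k + 1 \<le> 2 * x ^ k" by simp
  then have "(x ^ k + 1)\<^sup>2 \<le> (2 * x ^ k)\<^sup>2" by (rule power_mono) simp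
  then have "16 * (x ^ k + 1)\<^sup>2 \<le> 64 * x ^ (2 * k)"
    by (simp add: power_mult_distrib power_mult[symmetric] mult.commute)
  also note x
  also have "D * 2 ^ (4 * k * q) < 2 ^ D * 2 ^ (4 * k * q)" by simp
  also have "\<dots> = 2 ^ (D + 4 * k * q)" by (simp add: power_add)
  also have "\<dots> \<le> 2 ^ s" using s1 by (rule power_increasing) simp
  finally show ?thesis unfolding x_def by (intro exI[of _ s]) simp
qed

lemma parity_not_first_order:
  assumes "rel_arities \<sigma> \<noteq> []" "wf_fm \<sigma> [] \<phi>"
  shows "\<exists>n\<ge>1. \<exists>X\<subseteq>{..<n}. sat (set_struct \<sigma> n X) fs e \<phi> \<noteq> even (card X)"
proof (rule ccontr)
  assume "\<not> ?thesis"
  then have eq: "sat (set_struct \<sigma> n X) fs e \<phi> = even (card X)" if "1 \<le> n" "X \<subseteq> {..<n}" for n X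
    using that by blast
  obtain k where k: "\<And>n t. 1 \<le> n \<Longrightarrow> 1 \<le> t \<Longrightarrow>
      approximable n t ((2 * t) ^ k) ((n + 1) ^ k) (\<lambda>X. sat (set_struct \<sigma> n X) fs e \<phi>)"
    using fo_approximable[OF assms, of fs] by blast
  obtain s where s: "16 * ((2 * ((s + 2) * k + 2)) ^ k + 1)\<^sup>2 < 2 * 2 ^ s + (1::nat)"
    using polylog_growth by blast
  define m where "m = (2::nat) ^ s"
  \<comment> \<open>With m = 2 ^ s, this makes 2 ^ t equal to 4 (4 m) ^ k, at least 4 (2 m + 1) ^ k,
    so at most a quarter of the cube is in error.\<close>
  define t where "t = (s + 2) * k + 2"
  have m: "1 \<le> m" by (simp add: m_def)
  have "approximable (2 * m) t ((2 * t) ^ k) ((2 * m + 1) ^ k) (\<lambda>X. even (card X))"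
  proof (rule approximable_cong)
    show "approximable (2 * m) t ((2 * t) ^ k) ((2 * m + 1) ^ k) (\<lambda>X. sat (set_struct \<sigma> (2 * m) X) fs e \<phi>)"
      using m by (intro k) (auto simp: t_def)
    show "even (card X) = sat (set_struct \<sigma> (2 * m) X) fs e \<phi>" if "X \<subseteq> {..<2 * m}" for X
      using m that by (subst eq) auto
  qed
  then obtain p :: "nat set \<Rightarrow> 3" where p: "p \<in> polys (2 * m) ((2 * t) ^ k)"
    "2 ^ t * card {X. X \<subseteq> {..<2 * m} \<and> p X \<noteq> of_bool (even (card X))} \<le> (2 * m + 1) ^ k * 2 ^ (2 * m)"
    unfolding approximable_def by (rule bexE)
  let ?c = "card {X. X \<subseteq> {..<2 * m} \<and> p X \<noteq> of_bool (even (card X))}"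
  have "2 * m + 1 \<le> 4 * m" using m by simp
  also have "4 * m = 2 ^ (s + 2)" by (simp add: m_def)
  finally have "(2 * m + 1) ^ k \<le> (2 ^ (s + 2)) ^ k" by (rule power_mono) simp
  then have "(2 * m + 1) ^ k * 2 ^ (2 * m) \<le> 2 ^ ((s + 2) * k) * 4 ^ m"
    by (simp only: power_mult) (intro mult_mono, auto)
  with p(2) have "2 ^ t * ?c \<le> 2 ^ ((s + 2) * k) * 4 ^ m" by (rule order.trans)
  moreover have "2 ^ t = 2 ^ ((s + 2) * k) * (4::nat)" by (simp add: t_def power_add)
  ultimately have "2 ^ ((s + 2) * k) * (4 * ?c) \<le> 2 ^ ((s + 2) * k) * 4 ^ m"
    by (simp only: mult.assoc)
  then have "4 * ?c \<le> 4 ^ m" by (simp only: mult_le_cancel1) simp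
  from even_card_not_approximable[OF p(1) this]
  have "2 * m + 1 \<le> 16 * ((2 * t) ^ k + 1)\<^sup>2" .
  with s show False unfolding m_def t_def by linarith
qed

subsection \<open>Counting perfect matchings\<close>

text \<open>Both directions split off a two-element set and recurse: an arbitrary pair, swapped by
  the new map, in one case, and an orbit of \<open>h\<close> in the other.\<close>

lemma even_card_iff_involution:
  assumes "finite S"
  shows "even (card S) \<longleftrightarrow> (\<exists>h. \<forall>a\<in>S. h a \<in> S \<and> h a \<noteq> a \<and> h (h a) = a)"
proof
  assume "even (card S)"
  with assms show "\<exists>h. \<forall>a\<in>S. h a \<in> S \<and> h a \<noteq> a \<and> h (h a) = a"
  proof (induction "card S" arbitrary: S rule: less_induct)
    case less
    show ?case
    proof (cases "S = {}")
      case False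
      then obtain x where x: "x \<in> S" by blast
      have "S \<noteq> {x}" using less.prems by auto
      then obtain y where y: "y \<in> S" "y \<noteq> x" using x by blast
      let ?T = "S - {x, y}"
      have c: "card S = card ?T + 2"
        using x y less.prems(1) card_Diff_subset[of "{x, y}" S] card_mono[of S "{x, y}"] by simp
      then obtain h where h: "\<And>a. a \<in> ?T \<Longrightarrow> h a \<in> ?T \<and> h a \<noteq> a \<and> h (h a) = a"
        using less.hyps[of ?T] less.prems by auto
      have "\<forall>a\<in>S. (h(x := y, y := x)) a \<in> S \<and> (h(x := y, y := x)) a \<noteq> a
          \<and> (h(x := y, y := x)) ((h(x := y, y := x)) a) = a"
      proof
        fix a assume "a \<in> S"
        then consider "a = x" | "a = y" | "a \<in> ?T" by blast
        then show "(h(x := y, y := x)) a \<in> S \<and> (h(x := y, y := x)) a \<noteq> a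
          \<and> (h(x := y, y := x)) ((h(x := y, y := x)) a) = a"
        proof cases
          case 3
          then show ?thesis using h[of a] by auto
        qed (use x y in auto)
      qed
      then show ?thesis by blast
    qed simp
  qed
next
  assume "\<exists>h. \<forall>a\<in>S. h a \<in> S \<and> h a \<noteq> a \<and> h (h a) = a"
  then obtain h where "\<forall>a\<in>S. h a \<in> S \<and> h a \<noteq> a \<and> h (h a) = a" by blast
  with assms show "even (card S)"
  proof (induction "card S" arbitrary: S rule: less_induct)
    case less
    show ?case
    proof (cases "S = {}")
      case False
      then obtain x where x: "x \<in> S" by blast
      let ?T = "S - {x, h x}"
      have hx: "h x \<in> S" "h x \<noteq> x" using x less.prems(2) by auto
      have c: "card S = card ?T + 2"
        using x hx less.prems(1) card_Diff_subset[of "{x, h x}" S] card_mono[of S "{x, h x}"] by simp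
      have "h a \<in> ?T \<and> h a \<noteq> a \<and> h (h a) = a" if "a \<in> ?T" for a
        using that x less.prems(2) by (metis Diff_iff insert_iff empty_iff)
      then have "even (card ?T)" using less.hyps[of ?T] c less.prems(1) by auto
      then show ?thesis using c by simp
    qed simp
  qed
qed

definition unary_vocab :: vocab where
  "unary_vocab = \<lparr>rel_arities = [1], num_csts = 0\<rparr>"

text \<open>The inverse of the encoding for \<open>unary_vocab\<close>: a structure with a single
  unary relation is encoded by the characteristic word of that relation, whose length is the size of
  the universe.\<close>

definition word_struct :: "bool list \<Rightarrow> struct" where
  "word_struct w = \<lparr>usize = length w, rels = [{[i] | i. i < length w \<and> w ! i}], csts = []\<rparr>"

text \<open>The function restricts to a fixed-point free involution of the relation, that is, a
  perfect matching of it. Elsewhere it is free, which multiplies the count by a power of the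
  universe size and so preserves positivity.\<close>

definition matching_matrix :: fm where
  "matching_matrix = (let x = Var 0; y = FApp 0 [x] in
     Disj (Neg (Rel 0 [x])) (Conj (Rel 0 [y]) (Conj (Neg (Eq y x)) (Eq (FApp 0 [y]) x))))"

text \<open>The value at the empty word is arbitrary for \<^const>\<open>unary_vocab\<close>; the choice 2 rules out
  every vocabulary without relation symbols, for which the one-element structure is encoded by
  the empty word and has exactly one tuple of functions.\<close>

definition matching_count :: "bool list \<Rightarrow> nat" where
  "matching_count w = (if w = [] then 2
     else card {(fs, cs). fs \<in> fun_tuples (word_struct w) [1] \<and> cs \<in> tuples (universe (word_struct w)) 0 \<and>
            sat (word_struct w) fs (\<lambda>j. cs ! j) (Forall 0 matching_matrix)})"

lemma word_struct_enc:
  assumes "is_struct unary_vocab A"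
  shows "word_struct (enc unary_vocab A) = A" "enc unary_vocab A \<noteq> []"
proof -
  obtain n rs cs where A: "A = \<lparr>usize = n, rels = rs, csts = cs\<rparr>" by (cases A) auto
  then have n: "1 \<le> n" and cs: "cs = []" using assms by (auto simp: is_struct_def unary_vocab_def)
  obtain R where R: "rs = [R]" "R \<subseteq> tuples {..<n} 1"
    using assms A by (auto simp: is_struct_def unary_vocab_def universe_def list_all2_Cons2)
  have e: "enc unary_vocab A = map (\<lambda>i. [i] \<in> R) [0..<n]"
    unfolding A R cs by (simp add: enc_def unary_vocab_def enc_rel_def comp_def map_concat)
  show "enc unary_vocab A \<noteq> []" using e n by simp
  have "{[i] | i. i < n \<and> [i] \<in> R} = R"
    using R(2) by (auto simp: tuples_def length_Suc_conv)
  then show "word_struct (enc unary_vocab A) = A"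
    unfolding e unfolding A R(1) cs by (simp add: word_struct_def cong: conj_cong)
qed

lemma matching_count_in_sharp_Pi1: "matching_count \<in> sharp_Pi1"
proof -
  have "matching_count (enc unary_vocab A) = card {(fs, cs). fs \<in> fun_tuples A [1] \<and>
      cs \<in> tuples (universe A) 0 \<and> sat A fs (\<lambda>j. cs ! j) (Forall 0 matching_matrix)}"
    if "is_struct unary_vocab A" for A
    using word_struct_enc[OF that] by (simp add: matching_count_def)
  moreover have "vocabulary unary_vocab" by (simp add: vocabulary_def unary_vocab_def)
  moreover have "wf_fm unary_vocab [1] (Forall 0 matching_matrix)" "fv (Forall 0 matching_matrix) \<subseteq> {..<0}"
    "qfree matching_matrix"
    by (auto simp: matching_matrix_def Let_def unary_vocab_def)
  moreover have "Forall 0 matching_matrix = foldr Forall [0] matching_matrix" by simp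
  ultimately show ?thesis
    unfolding sharp_Pi1_def mem_Collect_eq
    by (intro exI[of _ unary_vocab] exI[of _ "[1]"] exI[of _ "0::nat"] exI[of _ "Forall 0 matching_matrix"]
      exI[of _ "[0]"] exI[of _ matching_matrix] conjI allI impI)
qed

lemma matching_count_pos_iff: "0 < matching_count w \<longleftrightarrow> even (length (filter id w))"
proof (cases "w = []")
  case False
  let ?A = "word_struct w" and ?n = "length w"
  let ?S = "{i. i < ?n \<and> w ! i}"
  let ?M = "{(fs, cs). fs \<in> fun_tuples ?A [1] \<and> cs \<in> tuples (universe ?A) 0 \<and>
            sat ?A fs (\<lambda>j. cs ! j) (Forall 0 matching_matrix)}"
  have U: "universe ?A = {..<?n}" by (simp add: universe_def word_struct_def)
  have sat: "sat ?A fs e (Forall 0 matching_matrix) \<longleftrightarrow>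
      (\<forall>a\<in>?S. (fs ! 0) [a] \<in> ?S \<and> (fs ! 0) [a] \<noteq> a \<and> (fs ! 0) [(fs ! 0) [a]] = a)" for fs e
    using U by (auto simp: matching_matrix_def Let_def word_struct_def)
  have "finite ?M"
    by (rule finite_subset[of _ "fun_tuples ?A [1] \<times> {[]}"]) (auto intro: finite_fun_tuples)
  then have "0 < card ?M \<longleftrightarrow> ?M \<noteq> {}" by (simp only: card_gt_0_iff simp_thms)
  also have "\<dots> \<longleftrightarrow> (\<exists>fs\<in>fun_tuples ?A [1].
      \<forall>a\<in>?S. (fs ! 0) [a] \<in> ?S \<and> (fs ! 0) [a] \<noteq> a \<and> (fs ! 0) [(fs ! 0) [a]] = a)"
    unfolding sat by auto
  also have "\<dots> \<longleftrightarrow> (\<exists>h. \<forall>a\<in>?S. h a \<in> ?S \<and> h a \<noteq> a \<and> h (h a) = a)"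
  proof
    assume "\<exists>fs\<in>fun_tuples ?A [1].
      \<forall>a\<in>?S. (fs ! 0) [a] \<in> ?S \<and> (fs ! 0) [a] \<noteq> a \<and> (fs ! 0) [(fs ! 0) [a]] = a"
    then obtain fs where "\<forall>a\<in>?S. (fs ! 0) [a] \<in> ?S \<and> (fs ! 0) [a] \<noteq> a \<and> (fs ! 0) [(fs ! 0) [a]] = a"
      by (rule bexE)
    then show "\<exists>h. \<forall>a\<in>?S. h a \<in> ?S \<and> h a \<noteq> a \<and> h (h a) = a"
      by (rule exI[of _ "\<lambda>a. (fs ! 0) [a]"])
  next
    assume "\<exists>h. \<forall>a\<in>?S. h a \<in> ?S \<and> h a \<noteq> a \<and> h (h a) = a"
    then obtain h where h: "\<forall>a\<in>?S. h a \<in> ?S \<and> h a \<noteq> a \<and> h (h a) = a" by (rule exE)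
    \<comment> \<open>Off \<open>?S\<close> the value 0 is a filler; it lies in the universe because
      \<open>w\<close> is nonempty.\<close>
    define F where "F = restrict (\<lambda>l. if hd l \<in> ?S then h (hd l) else 0) (tuples {..<?n} 1)"
    have F: "F [a] = h a" if "a \<in> ?S" for a
      using that by (simp add: F_def tuples_def)
    have "F \<in> tuples {..<?n} 1 \<rightarrow>\<^sub>E {..<?n}"
      using h False by (auto simp: F_def)
    then have "[F] \<in> fun_tuples ?A [1]" by (simp add: fun_tuples_def U)
    moreover have "\<forall>a\<in>?S. ([F] ! 0) [a] \<in> ?S \<and> ([F] ! 0) [a] \<noteq> a \<and> ([F] ! 0) [([F] ! 0) [a]] = a"
    proof
      fix a assume a: "a \<in> ?S"
      with h have "h a \<in> ?S" "h a \<noteq> a" "h (h a) = a" by auto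
      then show "([F] ! 0) [a] \<in> ?S \<and> ([F] ! 0) [a] \<noteq> a \<and> ([F] ! 0) [([F] ! 0) [a]] = a"
        using F[OF a] F[of "h a"] by simp
    qed
    ultimately show "\<exists>fs\<in>fun_tuples ?A [1].
      \<forall>a\<in>?S. (fs ! 0) [a] \<in> ?S \<and> (fs ! 0) [a] \<noteq> a \<and> (fs ! 0) [(fs ! 0) [a]] = a"
      by (rule bexI[rotated])
  qed
  also have "\<dots> \<longleftrightarrow> even (card ?S)"
    by (rule even_card_iff_involution[symmetric]) simp
  also have "card ?S = length (filter id w)" by (simp add: length_filter_conv_card)
  finally show ?thesis using False by (simp only: matching_count_def if_False)
qed (simp add: matching_count_def)

section \<open>Ones in encodings and the separation\<close>

lemma length_filter_enc_rel:
  assumes "R \<subseteq> tuples {..<n} a"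
  shows "length (filter id (enc_rel n a R)) = card R"
proof -
  have "set xs \<subseteq> {..<n} \<longleftrightarrow> (\<forall>i<length xs. xs ! i < n)" for xs
    by (simp add: subset_eq all_set_conv_all_nth)
  then have "set (product_lists (replicate a [0..<n])) = tuples {..<n} a"
    unfolding product_lists_set tuples_def list_all2_conv_all_nth by (intro Collect_cong) auto
  moreover have "distinct (product_lists (replicate a [0..<n]))"
    by (rule distinct_product_lists) auto
  ultimately show ?thesis
    using assms by (simp add: enc_rel_def distinct_length_filter Int_absorb2 comp_def)
qed

text \<open>The empty relations and the zero constants contribute only zeros. Thus, over any
  vocabulary with a relation symbol, the parity of the ones in the encoding is the parity of
  \<open>X\<close>.\<close>

lemma length_filter_enc_set_struct:
  assumes "vocabulary \<sigma>" "rel_arities \<sigma> \<noteq> []" "1 \<le> n" "X \<subseteq> {..<n}"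
  shows "length (filter id (enc \<sigma> (set_struct \<sigma> n X))) = card X"
proof -
  obtain a as where \<sigma>: "rel_arities \<sigma> = a # as" using assms(2) by (cases "rel_arities \<sigma>") auto
  let ?R = "(\<lambda>x. x # replicate (a - 1) 0) ` X"
  have R: "?R \<subseteq> tuples {..<n} a"
    using is_struct_set_struct[OF assms] \<sigma> by (simp add: is_struct_def set_struct_def universe_def)
  have empty: "filter id (concat (map2 (enc_rel n) as (replicate (length as) {}))) = []"
    by (auto simp: filter_empty_conv enc_rel_def in_set_zip)
  have csts: "filter id (concat (map (enc_cst n) (replicate c 0))) = []" for c
    by (auto simp: filter_empty_conv enc_cst_def)
  have "length (filter id (enc \<sigma> (set_struct \<sigma> n X))) = length (filter id (enc_rel n a ?R))"
    using empty csts by (simp add: enc_def set_struct_def \<sigma>)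
  also have "\<dots> = card X"
    unfolding length_filter_enc_rel[OF R] by (intro card_image inj_onI) simp
  finally show ?thesis .
qed

text \<open>Over a one-element universe there is only one extensional function of each arity. This
  settles vocabularies without relation symbols.\<close>

lemma card_fun_tuples_singleton:
  assumes "usize A = 1"
  shows "card {fs \<in> fun_tuples A as. P fs} \<le> 1"
proof -
  have "fs = gs" if "fs \<in> fun_tuples A as" "gs \<in> fun_tuples A as" for fs gs
  proof (rule nth_equalityI)
    have l: "length fs = length as" "length gs = length as"
      using that by (auto simp: fun_tuples_def dest: list_all2_lengthD)
    then show "length fs = length gs" by simp
    fix i assume "i < length fs"
    then have "fs ! i \<in> tuples (universe A) (as ! i) \<rightarrow>\<^sub>E universe A"
      "gs ! i \<in> tuples (universe A) (as ! i) \<rightarrow>\<^sub>E universe A"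
      using that l by (auto simp: fun_tuples_def list_all2_conv_all_nth simp del: PiE_iff)
    moreover have "universe A = {0}" using assms by (auto simp: universe_def)
    ultimately show "fs ! i = gs ! i"
      by (intro PiE_ext) auto
  qed
  moreover have "finite {fs \<in> fun_tuples A as. P fs}"
    using finite_fun_tuples by simp
  ultimately show ?thesis by (simp add: card_le_Suc0_iff_eq)
qed

lemma matching_count_notin_sharp_Pi1_Sk: "matching_count \<notin> sharp_Pi1_Sk"
proof
  assume "matching_count \<in> sharp_Pi1_Sk"
  then obtain \<sigma> m \<psi> where *: "vocabulary \<sigma>" "wf_fm \<sigma> [] (skolem_prefix m 0 \<psi>)"
    "fv (skolem_prefix m 0 \<psi>) = {}"
    "\<And>A. is_struct \<sigma> A \<Longrightarrow> matching_count (enc \<sigma> A) = card {fs \<in> fun_tuples A [0..<Suc m].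
                \<forall>zs\<in>tuples (universe A) m. sat A [] (skolem_env fs zs) \<psi>}"
    unfolding sharp_Pi1_Sk_def by blast
  have fv: "fv \<psi> \<subseteq> {..2 * m}" using *(3) by (auto simp: fv_skolem_prefix)
  show False
  proof (cases "rel_arities \<sigma> = []")
    case True
    let ?A = "\<lparr>usize = 1, rels = [], csts = replicate (num_csts \<sigma>) 0\<rparr>"
    have "is_struct \<sigma> ?A"
      using True by (auto simp: is_struct_def universe_def tuples_def)
    from *(4)[OF this] have "matching_count (enc \<sigma> ?A) \<le> 1"
      using card_fun_tuples_singleton[of ?A "[0..<Suc m]"] by (simp del: upt_Suc)
    \<comment> \<open>A constant takes log 1 = 0 bits over a one-element universe, so the encoding
      is the empty word, where \<open>matching_count\<close> is 2.\<close>
    moreover have "enc \<sigma> ?A = []"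
      using True by (simp add: enc_def enc_cst_def)
    ultimately show False by (simp add: matching_count_def)
  next
    case False
    obtain n X where X: "1 \<le> n" "X \<subseteq> {..<n}"
      "sat (set_struct \<sigma> n X) [] (\<lambda>_. 0) (skolem_prefix m 0 \<psi>) \<noteq> even (card X)"
      using parity_not_first_order[OF False *(2), of "[]" "\<lambda>_. 0"] by blast
    let ?A = "set_struct \<sigma> n X"
    have "is_struct \<sigma> ?A" using *(1) False X by (intro is_struct_set_struct)
    \<comment> \<open>The sentence that defines the Skolem count would hold exactly when
      \<open>X\<close> has even size, contradicting the choice of \<open>n\<close> and
      \<open>X\<close>.\<close>
    then have "sat ?A [] (\<lambda>_. 0) (skolem_prefix m 0 \<psi>) \<longleftrightarrow> 0 < matching_count (enc \<sigma> ?A)"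
      using skolem_functions_exist_iff[OF fv, of ?A "\<lambda>_. 0"] *(4) by (simp only:)
    also have "\<dots> \<longleftrightarrow> even (card X)"
      unfolding matching_count_pos_iff using length_filter_enc_set_struct[OF *(1) False X(1,2)] by simp
    finally show False using X(3) by simp
  qed
qed

theorem theorem6: "sharp_Pi1_Sk \<subset> sharp_Pi1"
  using sharp_Pi1_Sk_subset matching_count_in_sharp_Pi1 matching_count_notin_sharp_Pi1_Sk by blast

end
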